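(* Let $T$ be a $\Delta(1,2,2)$-free tournament and let $X\subseteq V(T)$. Then: (1) if $T[X]$ is isomorphic to $T_5$ or $P_7$, then $X$ is a homogeneous set of $T$; (2) if $T[X]$ is isomorphic to $P_7^-$, then the degree partition of $T[X]$ is a homogeneous pair of $T$; (3) substituting a basic tournament for a nice vertex of $T$, or applying a $P_7^-$-join to a bridge of $T$, results in a $\Delta(1,2,2)$-free tournament. Moreover, if $T$ contains a basic tournament, then $T$ can be constructed from a $\Delta(1,2,2)$-free tournament with fewer vertices by substituting a basic tournament for a nice vertex or by applying a $P_7^-$-join to a bridge.
   Context: Tournaments are finite; $uv\in E(T)$ means the edge is directed from $u$ to $v$; $T[X]$ is the induced subtournament, $T\setminus X=T[V(T)\setminus X]$; $T$ contains $S$ if some induced subtournament is isomorphic to $S$, otherwise $T$ is $S$-free. $X\Rightarrow Y$ means all edges between disjoint nonempty $X,Y$ go from $X$ to $Y$. $\Delta(1,2,2)$: vertices $x,y_1,y_2,z_1,z_2$ with $x\Rightarrow\{y_1,y_2\}\Rightarrow\{z_1,z_2\}\Rightarrow x$ and edges $y_1y_2,z_1z_2$. $T_5$: vertices $v_1,\dots,v_5$, $v_iv_j\in E$ iff $j-i\equiv1,2\pmod5$. $P_7$: $v_1,\dots,v_7$, $v_iv_j\in E$ iff $j-i\equiv1,2,4\pmod7$. $P_7^-$: $P_7$ minus a vertex. Basic tournaments: $T_5,P_7^-,P_7$. Degree partition of $P_7^-$: $(D_1,D_2)$, $D_1$ = vertices of out-degree $3$, $D_2$ = vertices of out-degree $2$.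 Homogeneous set: nonempty $X$ with $v\Rightarrow X$ or $X\Rightarrow v$ for each $v\notin X$. Homogeneous pair: disjoint nonempty $(A_1,A_2)$ with $A_1$ homogeneous in $T\setminus A_2$ and $A_2$ homogeneous in $T\setminus A_1$. Ordering $\sigma=(v_1,\dots,v_n)$; backedge graph $B_\sigma(T)$: undirected graph on $V(T)$ with edges $v_iv_j$ where $i>j$ and $v_iv_j\in E(T)$. Nice vertex $v$: no three distinct $x,y_1,y_2$ with both $\{v,x,y_1\}$, $\{v,x,y_2\}$ inducing cyclic triangles. Bridge: an edge $uv\in E(T)$ such that for some ordering $\sigma=(v_1,\dots,v_n)$ with $u=v_i$, $v=v_j$, $i>j$, $uv$ is an isolated edge of $B_\sigma(T)$ and the edges of $B_\sigma(T)$ between $\{v_s:s<i\}$ and $\{v_t:t>i\}$, and also between $\{v_s:s<j\}$ and $\{v_t:t>j\}$, form matchings. Substituting $S_2$ for $v\in V(S_1)$: replace $v$ by a copy of $S_2$, and for $x_1\ne v$, $x_2\in V(S_2)$ direct $x_1x_2$ iff $x_1v\in E(S_1)$. $P_7^-$-join to an edge $uv$ of $J$: replace $u,v$ by a copy $S$ of $P_7^-$ with degree partition $(D_1,D_2)$; each remaining vertex $w$ is joined to all of $D_2$ as it was to $u$ and to all of $D_1$ as it was to $v$; all other edges as in $J$ and $S$. *)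

theory Defs
  imports "Graph_Theory.Graph_Theory"
begin

section \<open>Tournaments and containment\<close>

locale tournament = digraph G for G :: "('a, 'b) pre_digraph" (structure) +
  assumes exactly_one_arc:
    "\<lbrakk>u \<in> verts G; v \<in> verts G; u \<noteq> v\<rbrakk> \<Longrightarrow> u \<rightarrow>\<^bsub>G\<^esub> v \<longleftrightarrow> \<not> v \<rightarrow>\<^bsub>G\<^esub> u"

definition contains :: "('a, 'b) pre_digraph \<Rightarrow> ('c, 'd) pre_digraph \<Rightarrow> bool" where
  "contains G S \<longleftrightarrow> (\<exists>X \<subseteq> verts G. digraph_iso (G \<restriction> X) S)"

definition is_free :: "('a, 'b) pre_digraph \<Rightarrow> ('c, 'd) pre_digraph \<Rightarrow> bool" where
  "is_free G S \<longleftrightarrow> \<not> contains G S"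

definition all_arcs_to :: "('a, 'b) pre_digraph \<Rightarrow> 'a set \<Rightarrow> 'a set \<Rightarrow> bool" where
  "all_arcs_to G X Y \<longleftrightarrow> (\<forall>x \<in> X. \<forall>y \<in> Y. x \<rightarrow>\<^bsub>G\<^esub> y)"


section \<open>The particular tournaments\<close>

text \<open>The vertices \<open>x, y\<^sub>1, y\<^sub>2, z\<^sub>1, z\<^sub>2\<close> are encoded as \<open>0, 1, 2, 3, 4\<close>.\<close>

definition Delta122 :: "(nat, nat \<times> nat) pre_digraph" where
  "Delta122 = with_proj \<lparr> pverts = {0, 1, 2, 3, 4},
     parcs = {0} \<times> {1, 2} \<union> {1, 2} \<times> {3, 4} \<union> {3, 4} \<times> {0} \<union> {(1, 2), (3, 4)} \<rparr>"

definition T5 :: "(int, int \<times> int) pre_digraph" where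
  "T5 = with_proj \<lparr> pverts = {1..5},
     parcs = {(i, j). i \<in> {1..5} \<and> j \<in> {1..5} \<and> (j - i) mod 5 \<in> {1, 2}} \<rparr>"

definition P7 :: "(int, int \<times> int) pre_digraph" where
  "P7 = with_proj \<lparr> pverts = {1..7},
     parcs = {(i, j). i \<in> {1..7} \<and> j \<in> {1..7} \<and> (j - i) mod 7 \<in> {1, 2, 4}} \<rparr>"

text \<open>\<open>P7\<close> with one vertex removed; which vertex does not matter, see
  \<open>del_vert_P7_iso\<close> below.\<close>

definition P7m :: "(int, int \<times> int) pre_digraph" where
  "P7m = pre_digraph.del_vert P7 7"

lemma del_vert_P7_iso:
  assumes "v \<in> verts P7"
  shows "digraph_iso (pre_digraph.del_vert P7 v) P7m"
proof -
  define f :: "int \<Rightarrow> int" where "f w = (w - v - 1) mod 7 + 1" for w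
  define h :: "(int, int \<times> int, int, int \<times> int) digraph_isomorphism" where
    "h = \<lparr> iso_verts = f, iso_arcs = map_prod f f, iso_head = snd, iso_tail = fst \<rparr>"
  define g :: "int \<Rightarrow> int" where "g w = (w + v - 1) mod 7 + 1" for w
  have v: "1 \<le> v" "v \<le> 7" using assms by (auto simp: P7_def)
  have f: "f a \<in> {1..7}" for a unfolding f_def atLeastAtMost_iff by presburger
  have g: "g a \<in> {1..7}" for a unfolding g_def atLeastAtMost_iff by presburger
  have res: "(a - 1) mod 7 + 1 = a" if "a \<in> {1..7}" for a :: int
    using that by (simp add: mod_pos_pos_trivial)
  have fg: "f (g a) = a" if "a \<in> {1..7}" for a
    using res[OF that] by (simp add: f_def g_def mod_simps)
  have gf: "g (f a) = a" if "a \<in> {1..7}" for a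
    using res[OF that] by (simp add: f_def g_def mod_simps)
  have "f v = 7" by (simp add: f_def)
  then have f7: "f a = 7 \<longleftrightarrow> a = v" if "a \<in> {1..7}" for a
    using that v gf by (metis atLeastAtMost_iff)
  have "g 7 = v" using gf[of v] v \<open>f v = 7\<close> by simp
  then have g7: "g a = v \<longleftrightarrow> a = 7" if "a \<in> {1..7}" for a
    using that fg \<open>f v = 7\<close> by metis
  have df: "(f b - f a) mod 7 = (b - a) mod 7" for a b
    by (simp add: f_def mod_simps)
  have dg: "(g b - g a) mod 7 = (b - a) mod 7" for a b
    by (simp add: g_def mod_simps)
  have inj: "inj_on f {1..7}" by (metis gf inj_onI)
  have "pre_digraph.digraph_isomorphism (pre_digraph.del_vert P7 v) h"
    using inj by (auto simp: pre_digraph.digraph_isomorphism_def h_def P7_def pre_digraph.del_vert_def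
       wf_digraph_def inj_on_def)
  moreover have "P7m = app_iso h (pre_digraph.del_vert P7 v)"
  proof -
    have "f ` ({1..7} - {v}) = {1..7} - {7}"
    proof (intro equalityI subsetI)
      fix a assume "a \<in> {1..7::int} - {7}"
      then show "a \<in> f ` ({1..7} - {v})"
        using g[of a] fg[of a] g7[of a] by (intro image_eqI[where x = "g a"]) auto
    next
      fix b assume "b \<in> f ` ({1..7} - {v})"
      then obtain a where "a \<in> {1..7}" "a \<noteq> v" "b = f a" by blast
      then show "b \<in> {1..7} - {7}" using f[of a] f7[of a] by simp
    qed
    moreover have "map_prod f f ` {e \<in> arcs P7. fst e \<noteq> v \<and> snd e \<noteq> v}
        = {e \<in> arcs P7. fst e \<noteq> 7 \<and> snd e \<noteq> 7}" (is "map_prod f f ` ?A = ?B")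
    proof (intro equalityI subsetI)
      fix e assume "e \<in> map_prod f f ` ?A"
      then obtain a b where ab: "(a, b) \<in> arcs P7" "a \<noteq> v" "b \<noteq> v" "e = (f a, f b)" by auto
      then have "a \<in> {1..7}" "b \<in> {1..7}" "(b - a) mod 7 \<in> {1, 2, 4}" by (auto simp: P7_def)
      then have "(f a, f b) \<in> arcs P7" using f[of a] f[of b] df[of b a] by (simp add: P7_def)
      then show "e \<in> ?B" using ab f7 \<open>a \<in> {1..7}\<close> \<open>b \<in> {1..7}\<close> by simp
    next
      fix e assume "e \<in> ?B"
      then obtain a b where ab: "(a, b) \<in> arcs P7" "a \<noteq> 7" "b \<noteq> 7" "e = (a, b)" by (cases e) auto
      then have r: "a \<in> {1..7}" "b \<in> {1..7}" "(b - a) mod 7 \<in> {1, 2, 4}" by (auto simp: P7_def)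
      then have "(g a, g b) \<in> arcs P7" using g[of a] g[of b] dg[of b a] by (simp add: P7_def)
      then have "(g a, g b) \<in> ?A" using ab g7 r by simp
      moreover have "e = map_prod f f (g a, g b)" using ab fg r by simp
      ultimately show "e \<in> map_prod f f ` ?A" by blast
    qed
    ultimately show ?thesis
      by (simp add: P7m_def h_def P7_def pre_digraph.del_vert_def app_iso_def with_proj_def)
  qed
  ultimately show ?thesis unfolding digraph_iso_def by blast
qed

definition basic_tournaments :: "(int, int \<times> int) pre_digraph set" where
  "basic_tournaments = {T5, P7m, P7}"

definition D1 :: "('a, 'b) pre_digraph \<Rightarrow> 'a set" where
  "D1 S = {w \<in> verts S. out_degree S w = 3}"

definition D2 :: "('a, 'b) pre_digraph \<Rightarrow> 'a set" where
  "D2 S = {w \<in> verts S. out_degree S w = 2}"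


section \<open>Homogeneous sets and pairs\<close>

definition homogeneous_set :: "('a, 'b) pre_digraph \<Rightarrow> 'a set \<Rightarrow> bool" where
  "homogeneous_set G X \<longleftrightarrow> X \<noteq> {} \<and> X \<subseteq> verts G \<and>
     (\<forall>v \<in> verts G - X. all_arcs_to G {v} X \<or> all_arcs_to G X {v})"

definition homogeneous_pair :: "('a, 'b) pre_digraph \<Rightarrow> 'a set \<Rightarrow> 'a set \<Rightarrow> bool" where
  "homogeneous_pair G A B \<longleftrightarrow>
     A \<noteq> {} \<and> B \<noteq> {} \<and> A \<inter> B = {} \<and> A \<subseteq> verts G \<and> B \<subseteq> verts G \<and>
     homogeneous_set (G \<restriction> (verts G - B)) A \<and>
     homogeneous_set (G \<restriction> (verts G - A)) B"


section \<open>Nice vertices and bridges\<close>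

definition cyclic_triangle :: "('a, 'b) pre_digraph \<Rightarrow> 'a \<Rightarrow> 'a \<Rightarrow> 'a \<Rightarrow> bool" where
  "cyclic_triangle G a b c \<longleftrightarrow>
     (a \<rightarrow>\<^bsub>G\<^esub> b \<and> b \<rightarrow>\<^bsub>G\<^esub> c \<and> c \<rightarrow>\<^bsub>G\<^esub> a) \<or> (a \<rightarrow>\<^bsub>G\<^esub> c \<and> c \<rightarrow>\<^bsub>G\<^esub> b \<and> b \<rightarrow>\<^bsub>G\<^esub> a)"

definition nice_vertex :: "('a, 'b) pre_digraph \<Rightarrow> 'a \<Rightarrow> bool" where
  "nice_vertex G v \<longleftrightarrow> v \<in> verts G \<and>
     \<not> (\<exists>x y1 y2. distinct [x, y1, y2] \<and> cyclic_triangle G v x y1 \<and> cyclic_triangle G v x y2)"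

definition vertex_ordering :: "('a, 'b) pre_digraph \<Rightarrow> 'a list \<Rightarrow> bool" where
  "vertex_ordering G \<sigma> \<longleftrightarrow> distinct \<sigma> \<and> set \<sigma> = verts G"

text \<open>The backedge graph is undirected and is represented by its set of edges, each a
  two-element set of vertices; its vertex set is \<open>verts G\<close>.\<close>

definition backedges :: "('a, 'b) pre_digraph \<Rightarrow> 'a list \<Rightarrow> 'a set set" where
  "backedges G \<sigma> = {{\<sigma> ! i, \<sigma> ! j} | i j. i < length \<sigma> \<and> j < i \<and> \<sigma> ! i \<rightarrow>\<^bsub>G\<^esub> \<sigma> ! j}"

definition isolated_edge :: "'a set set \<Rightarrow> 'a set \<Rightarrow> bool" where
  "isolated_edge F e \<longleftrightarrow> e \<in> F \<and> (\<forall>f \<in> F. f \<noteq> e \<longrightarrow> f \<inter> e = {})"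

definition edges_between :: "'a set set \<Rightarrow> 'a set \<Rightarrow> 'a set \<Rightarrow> 'a set set" where
  "edges_between F A B = {e \<in> F. \<exists>a \<in> A. \<exists>b \<in> B. e = {a, b}}"

definition is_matching :: "'a set set \<Rightarrow> bool" where
  "is_matching M \<longleftrightarrow> (\<forall>e \<in> M. \<forall>f \<in> M. e \<noteq> f \<longrightarrow> e \<inter> f = {})"

definition matching_across :: "('a, 'b) pre_digraph \<Rightarrow> 'a list \<Rightarrow> nat \<Rightarrow> bool" where
  "matching_across G \<sigma> k \<longleftrightarrow>
     is_matching (edges_between (backedges G \<sigma>)
       {\<sigma> ! s | s. s < k} {\<sigma> ! t | t. k < t \<and> t < length \<sigma>})"

definition bridge :: "('a, 'b) pre_digraph \<Rightarrow> 'a \<Rightarrow> 'a \<Rightarrow> bool" where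
  "bridge G u v \<longleftrightarrow> u \<rightarrow>\<^bsub>G\<^esub> v \<and>
     (\<exists>\<sigma> i j. vertex_ordering G \<sigma> \<and> i < length \<sigma> \<and> j < i \<and> u = \<sigma> ! i \<and> v = \<sigma> ! j \<and>
        isolated_edge (backedges G \<sigma>) {u, v} \<and>
        matching_across G \<sigma> i \<and> matching_across G \<sigma> j)"


section \<open>Substitution and joins\<close>

text \<open>Both constructions live on a sum type: \<open>Inl\<close> marks the vertices kept from the original
  tournament and \<open>Inr\<close> those of the inserted copy.\<close>

definition substitute ::
  "('a, 'b) pre_digraph \<Rightarrow> 'a \<Rightarrow> ('c, 'd) pre_digraph \<Rightarrow> ('a + 'c, ('a + 'c) \<times> ('a + 'c)) pre_digraph"
where
  "substitute G v S = (let R = verts G - {v} in with_proj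
     \<lparr> pverts = Inl ` R \<union> Inr ` verts S,
       parcs =
         {(Inl a, Inl b) | a b. a \<in> R \<and> b \<in> R \<and> a \<rightarrow>\<^bsub>G\<^esub> b}
         \<union> {(Inr s, Inr t) | s t. s \<rightarrow>\<^bsub>S\<^esub> t}
         \<union> {(Inl w, Inr s) | w s. w \<in> R \<and> s \<in> verts S \<and> w \<rightarrow>\<^bsub>G\<^esub> v}
         \<union> {(Inr s, Inl w) | w s. w \<in> R \<and> s \<in> verts S \<and> v \<rightarrow>\<^bsub>G\<^esub> w} \<rparr>)"

text \<open>The vertices in \<open>D2 P7m\<close> play the role of \<open>u\<close>, those in \<open>D1 P7m\<close> the role of \<open>v\<close>.\<close>

definition P7m_join ::
  "('a, 'b) pre_digraph \<Rightarrow> 'a \<Rightarrow> 'a \<Rightarrow> ('a + int, ('a + int) \<times> ('a + int)) pre_digraph"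
where
  "P7m_join G u v = (let R = verts G - {u, v} in with_proj
     \<lparr> pverts = Inl ` R \<union> Inr ` verts P7m,
       parcs =
         {(Inl a, Inl b) | a b. a \<in> R \<and> b \<in> R \<and> a \<rightarrow>\<^bsub>G\<^esub> b}
         \<union> {(Inr s, Inr t) | s t. s \<rightarrow>\<^bsub>P7m\<^esub> t}
         \<union> {(Inl w, Inr s) | w s. w \<in> R \<and> s \<in> D2 P7m \<and> w \<rightarrow>\<^bsub>G\<^esub> u}
         \<union> {(Inr s, Inl w) | w s. w \<in> R \<and> s \<in> D2 P7m \<and> u \<rightarrow>\<^bsub>G\<^esub> w}
         \<union> {(Inl w, Inr s) | w s. w \<in> R \<and> s \<in> D1 P7m \<and> w \<rightarrow>\<^bsub>G\<^esub> v}
         \<union> {(Inr s, Inl w) | w s. w \<in> R \<and> s \<in> D1 P7m \<and> v \<rightarrow>\<^bsub>G\<^esub> w} \<rparr>)"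

end

theory Submission
  imports Defs
begin

text \<open>A vertex \<open>w\<close> outside a copy of a basic tournament is described by its set of out-neighbours in
  that copy, so (1) and (2) amount to a finite check of all one-vertex extensions. For \<open>P7m\<close> the
  surviving extensions are those in which \<open>w\<close> respects the degree partition \<open>(D\<^sub>1, D\<^sub>2)\<close>; if
  moreover \<open>w \<Rightarrow> D\<^sub>1\<close> and \<open>D\<^sub>2 \<Rightarrow> w\<close>, then \<open>w\<close> completes a copy of \<open>P7\<close>.

  If \<open>T\<close> contains \<open>T5\<close> or \<open>P7\<close>, the copy is homogeneous and is contracted to one vertex; were that
  vertex not nice, the two cyclic triangles and two vertices of the copy would form
  \<open>\<Delta>(1,2,2)\<close>. Otherwise a copy of \<open>P7m\<close> is contracted to \<open>u, v\<close>, and every other vertex lies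
  before both in the order \<open>v, u\<close>, between them, or after both. Two arcs with a common end
  violating one of the matching conditions would form \<open>\<Delta>(1,2,2)\<close> with two vertices of \<open>D\<^sub>1\<close> or
  of \<open>D\<^sub>2\<close>.

  Conversely, a copy of \<open>\<Delta>(1,2,2)\<close> in a substituted tournament meets the inserted part in a
  homogeneous set, that is, in at most one vertex, in one of the pairs \<open>{y\<^sub>1, y\<^sub>2}\<close>,
  \<open>{z\<^sub>1, z\<^sub>2}\<close>, or in everything. A copy in a \<open>P7m\<close>-join meets the inserted part in at most one
  of its arcs from \<open>D\<^sub>2\<close> to \<open>D\<^sub>1\<close>, hence comes from a copy in the original tournament.\<close>

text \<open>As an elimination rule, \<open>reachableE\<close> makes the classical reasoner unfold every arc.\<close>

declare reachableE[rule del]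

section \<open>Tournaments and isomorphisms\<close>

lemma arcs_ends_induce: "arcs_ends (G \<restriction> X) = {(a, b) \<in> arcs_ends G. a \<in> X \<and> b \<in> X}"
  by (auto simp: arcs_ends_conv induce_subgraph_def)

text \<open>An isomorphism also carries an arc map. Without parallel arcs an arc is determined by
  its ends, so a bijection of the vertices that preserves and reflects adjacency already induces
  that map.\<close>

lemma digraph_iso_iff:
  assumes "nomulti_digraph G" and "nomulti_digraph H"
  shows "digraph_iso G H \<longleftrightarrow> (\<exists>f. bij_betw f (verts G) (verts H) \<and>
    (\<forall>a\<in>verts G. \<forall>b\<in>verts G. a \<rightarrow>\<^bsub>G\<^esub> b \<longleftrightarrow> f a \<rightarrow>\<^bsub>H\<^esub> f b))" (is "?L \<longleftrightarrow> ?R")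
proof
  interpret G: nomulti_digraph G by fact
  assume ?L
  then obtain h where h: "G.digraph_isomorphism h" "H = app_iso h G"
    by (auto simp: digraph_iso_def)
  have inj: "inj_on (iso_verts h) (verts G)"
    using h(1) by (rule G.digraph_isomorphism_inj_on_verts)
  have "a \<rightarrow>\<^bsub>G\<^esub> b \<longleftrightarrow> iso_verts h a \<rightarrow>\<^bsub>H\<^esub> iso_verts h b"
    if "a \<in> verts G" "b \<in> verts G" for a b
    using that inj unfolding h(2) G.arcs_ends_app_iso_eq[OF h(1)]
    by (auto simp: inj_on_eq_iff G.adj_in_verts intro: rev_image_eqI)
  moreover have "bij_betw (iso_verts h) (verts G) (verts H)"
    using inj h(2) by (simp add: bij_betw_def)
  ultimately show ?R by blast
next
  interpret G: nomulti_digraph G by fact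
  interpret H: nomulti_digraph H by fact
  assume ?R
  then obtain f where f: "bij_betw f (verts G) (verts H)"
    and adj: "\<And>a b. a \<in> verts G \<Longrightarrow> b \<in> verts G \<Longrightarrow> a \<rightarrow>\<^bsub>G\<^esub> b \<longleftrightarrow> f a \<rightarrow>\<^bsub>H\<^esub> f b"
    by blast
  \<comment> \<open>The arc of \<open>H\<close> whose ends are the images of the ends of
    \<open>e\<close>; \<open>arc_to_ends H\<close> is injective on arcs and can be inverted.\<close>
  define F where "F e = the_inv_into (arcs H) (arc_to_ends H) (f (tail G e), f (head G e))" for e
  have ex: "\<exists>e'\<in>arcs H. arc_to_ends H e' = (f (tail G e), f (head G e))" if "e \<in> arcs G" for e
  proof -
    have "tail G e \<rightarrow>\<^bsub>G\<^esub> head G e" using that by (auto simp: arcs_ends_conv)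
    then have "f (tail G e) \<rightarrow>\<^bsub>H\<^esub> f (head G e)" using adj that by simp
    then show ?thesis by (force simp: arcs_ends_def)
  qed
  have F: "F e \<in> arcs H" "tail H (F e) = f (tail G e)" "head H (F e) = f (head G e)"
    if "e \<in> arcs G" for e
  proof -
    have m: "(f (tail G e), f (head G e)) \<in> arc_to_ends H ` arcs H"
      using ex[OF that] by (metis image_eqI)
    show "F e \<in> arcs H" unfolding F_def
      by (rule the_inv_into_into[OF H.inj_on_arc_to_ends m order_refl])
    have "arc_to_ends H (F e) = (f (tail G e), f (head G e))" unfolding F_def
      by (rule f_the_inv_into_f[OF H.inj_on_arc_to_ends m])
    then show "tail H (F e) = f (tail G e)" "head H (F e) = f (head G e)"
      by (auto simp: arc_to_ends_def)
  qed
  have injf: "inj_on f (verts G)" using f by (rule bij_betw_imp_inj_on)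
  have "inj_on F (arcs G)"
  proof (rule inj_onI)
    fix e e' assume e: "e \<in> arcs G" "e' \<in> arcs G" "F e = F e'"
    then have "f (tail G e) = f (tail G e')" "f (head G e) = f (head G e')"
      using F by metis+
    then have "arc_to_ends G e = arc_to_ends G e'"
      using injf e by (auto simp: arc_to_ends_def dest: inj_onD)
    then show "e = e'" using e G.no_multi_arcs by blast
  qed
  moreover have "arcs H = F ` arcs G"
  proof (intro equalityI subsetI)
    fix e' assume e': "e' \<in> arcs H"
    then obtain a b where ab: "a \<in> verts G" "b \<in> verts G" "tail H e' = f a" "head H e' = f b"
      using f H.tail_in_verts H.head_in_verts unfolding bij_betw_def by (metis imageE)
    then have "f a \<rightarrow>\<^bsub>H\<^esub> f b" using e' by (auto simp: arcs_ends_conv intro!: image_eqI)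
    then have "a \<rightarrow>\<^bsub>G\<^esub> b" using adj ab by blast
    then obtain e where e: "e \<in> arcs G" "tail G e = a" "head G e = b"
      by (rule reachableE)
    then have "arc_to_ends H (F e) = arc_to_ends H e'" using F ab by (simp add: arc_to_ends_def)
    then have "F e = e'" using F e e' H.no_multi_arcs by blast
    then show "e' \<in> F ` arcs G" using e by blast
  qed (use F in auto)
  ultimately show ?L
    unfolding digraph_iso_def pre_digraph.digraph_isomorphism_def
    by (intro exI[where x = "\<lparr>iso_verts = f, iso_arcs = F, iso_head = head H, iso_tail = tail H\<rparr>"])
      (use injf F f in \<open>auto simp: app_iso_def bij_betw_def G.wf_digraph\<close>)
qed

text \<open>The bijection now runs from \<open>H\<close> to \<open>G\<close>, so that the numbered
  vertices of a fixed tournament can index a copy of it.\<close>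

lemma digraph_iso_iff_inv:
  assumes "nomulti_digraph G" and "nomulti_digraph H"
  shows "digraph_iso G H \<longleftrightarrow> (\<exists>g. bij_betw g (verts H) (verts G) \<and>
    (\<forall>a\<in>verts H. \<forall>b\<in>verts H. a \<rightarrow>\<^bsub>H\<^esub> b \<longleftrightarrow> g a \<rightarrow>\<^bsub>G\<^esub> g b))"
proof -
  have "digraph_iso G H \<longleftrightarrow> digraph_iso H G"
    using assms digraph_iso_swap[of G H] digraph_iso_swap[of H G]
    by (auto simp: nomulti_digraph_def)
  then show ?thesis using digraph_iso_iff[OF assms(2,1)] by simp
qed

lemma tournament_with_proj:
  assumes "finite V" and "R \<subseteq> V \<times> V"
    and "\<And>a b. a \<in> V \<Longrightarrow> b \<in> V \<Longrightarrow> a \<noteq> b \<Longrightarrow> (a, b) \<in> R \<longleftrightarrow> (b, a) \<notin> R"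
    and "\<And>a. (a, a) \<notin> R"
  shows "tournament (with_proj \<lparr> pverts = V, parcs = R \<rparr>)"
proof
  show "a \<rightarrow>\<^bsub>with_proj \<lparr> pverts = V, parcs = R \<rparr>\<^esub> b
      \<longleftrightarrow> \<not> b \<rightarrow>\<^bsub>with_proj \<lparr> pverts = V, parcs = R \<rparr>\<^esub> a"
    if "a \<in> verts (with_proj \<lparr> pverts = V, parcs = R \<rparr>)"
      "b \<in> verts (with_proj \<lparr> pverts = V, parcs = R \<rparr>)" "a \<noteq> b" for a b
    using assms(3)[of a b] that by simp
  show "finite (arcs (with_proj \<lparr> pverts = V, parcs = R \<rparr>))"
    using assms(1,2) by (simp add: finite_subset)
qed (use assms(1,2,4) in \<open>auto simp: arc_to_ends_def\<close>)

lemma tournament_induce: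
  assumes "tournament G" and "X \<subseteq> verts G"
  shows "tournament (G \<restriction> X)"
proof -
  interpret tournament G by fact
  show ?thesis
  proof
    show "finite (verts (G \<restriction> X))" using assms(2) by (simp add: finite_subset)
    show "finite (arcs (G \<restriction> X))" by (simp add: induce_subgraph_def)
    show "tail (G \<restriction> X) e \<noteq> head (G \<restriction> X) e" if "e \<in> arcs (G \<restriction> X)" for e
      using that no_loops by (simp add: induce_subgraph_def)
    show "e1 = e2" if "e1 \<in> arcs (G \<restriction> X)" "e2 \<in> arcs (G \<restriction> X)"
      "arc_to_ends (G \<restriction> X) e1 = arc_to_ends (G \<restriction> X) e2" for e1 e2
      using that no_multi_arcs by (simp add: induce_subgraph_def arc_to_ends_def)
    show "a \<rightarrow>\<^bsub>G \<restriction> X\<^esub> b \<longleftrightarrow> \<not> b \<rightarrow>\<^bsub>G \<restriction> X\<^esub> a"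
      if "a \<in> verts (G \<restriction> X)" "b \<in> verts (G \<restriction> X)" "a \<noteq> b" for a b
      using that exactly_one_arc[of a b] assms(2) by (auto simp: arcs_ends_induce)
  qed (auto simp: induce_subgraph_def)
qed

text \<open>The arcs inside the two pairs are left open: in a tournament either orientation gives
  \<open>\<Delta>(1,2,2)\<close>.\<close>

definition delta :: "('c \<Rightarrow> 'c \<Rightarrow> bool) \<Rightarrow> 'c \<Rightarrow> 'c \<Rightarrow> 'c \<Rightarrow> 'c \<Rightarrow> 'c \<Rightarrow> bool" where
  "delta E x y1 y2 z1 z2 \<longleftrightarrow> E x y1 \<and> E x y2 \<and> y1 \<noteq> y2 \<and> E y1 z1 \<and> E y1 z2 \<and> E y2 z1 \<and> E y2 z2
     \<and> z1 \<noteq> z2 \<and> E z1 x \<and> E z2 x"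

section \<open>Copies inside a tournament, expressed by arcs\<close>

context tournament
begin

lemma tournament: "tournament G" by unfold_locales

lemma asym: "a \<rightarrow> b \<Longrightarrow> \<not> b \<rightarrow> a"
  using exactly_one_arc[of a b] adj_in_verts[of a b] adj_not_same[of a] by blast

lemma irrefl: "\<not> a \<rightarrow> a"
  using adj_not_same by blast

lemma total: "a \<in> verts G \<Longrightarrow> b \<in> verts G \<Longrightarrow> a \<noteq> b \<Longrightarrow> a \<rightarrow> b \<or> b \<rightarrow> a"
  using exactly_one_arc by blast

lemma digraph_iso_induce_iff:
  assumes "nomulti_digraph S" and "X \<subseteq> verts G"
  shows "digraph_iso (G \<restriction> X) S \<longleftrightarrow> (\<exists>g. bij_betw g (verts S) X \<and>
    (\<forall>a\<in>verts S. \<forall>b\<in>verts S. a \<rightarrow>\<^bsub>S\<^esub> b \<longleftrightarrow> g a \<rightarrow> g b))"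
proof -
  interpret X: tournament "G \<restriction> X" by (rule tournament_induce[OF tournament assms(2)])
  have "g a \<rightarrow>\<^bsub>G \<restriction> X\<^esub> g b \<longleftrightarrow> g a \<rightarrow> g b"
    if "bij_betw g (verts S) X" "a \<in> verts S" "b \<in> verts S" for g :: "'c \<Rightarrow> 'a" and a b
    using that by (simp add: arcs_ends_induce bij_betw_apply)
  then show ?thesis
    unfolding digraph_iso_iff_inv[OF X.nomulti_digraph assms(1)]
    by (intro ex_cong1 conj_cong ball_cong) simp_all
qed

text \<open>Replaces isomorphisms by arcs between five named vertices, the form in which freeness is
  used later. The two arcs that \<open>delta\<close> leaves open are oriented as in
  \<open>Delta122\<close> by swapping \<open>y1\<close>, \<open>y2\<close> or \<open>z1\<close>,
  \<open>z2\<close>.\<close>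

lemma is_free_Delta122_iff:
  "is_free G Delta122 \<longleftrightarrow> (\<forall>x y1 y2 z1 z2. \<not> delta (\<lambda>a b. a \<rightarrow> b) x y1 y2 z1 z2)"
proof -
  have D: "nomulti_digraph Delta122"
    unfolding Delta122_def by unfold_locales (auto simp: arc_to_ends_def)
  have vD: "verts Delta122 = {0, 1, 2, 3, 4}" by (simp add: Delta122_def)
  have fwd: "\<exists>x y1 y2 z1 z2. delta (\<lambda>a b. a \<rightarrow> b) x y1 y2 z1 z2"
    if X: "X \<subseteq> verts G" "digraph_iso (G \<restriction> X) Delta122" for X
  proof -
    obtain g where g: "bij_betw g (verts Delta122) X"
      "\<And>a b. a \<in> verts Delta122 \<Longrightarrow> b \<in> verts Delta122 \<Longrightarrow> a \<rightarrow>\<^bsub>Delta122\<^esub> b \<Longrightarrow> g a \<rightarrow> g b"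
      using X(2) unfolding digraph_iso_induce_iff[OF D X(1)] by blast
    have arc: "g a \<rightarrow> g b" if "(a, b) \<in> {0} \<times> {1, 2} \<union> {1, 2} \<times> {3, 4} \<union> {3, 4} \<times> {0} \<union> {(1, 2), (3, 4)}" for a b
      by (rule g(2)) (use that in \<open>auto simp: Delta122_def\<close>)
    have "g 1 \<noteq> g 2" "g 3 \<noteq> g 4"
      using arc[of 1 2] arc[of 3 4] irrefl[of "g 2"] irrefl[of "g 4"] by auto
    then have "delta (\<lambda>a b. a \<rightarrow> b) (g 0) (g 1) (g 2) (g 3) (g 4)"
      unfolding delta_def by (simp add: arc)
    then show ?thesis by blast
  qed
  have bwd: "\<exists>X\<subseteq>verts G. digraph_iso (G \<restriction> X) Delta122"
    if d: "delta (\<lambda>a b. a \<rightarrow> b) x y1 y2 z1 z2" for x y1 y2 z1 z2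
  proof -
    have in_verts: "y1 \<in> verts G" "y2 \<in> verts G" "z1 \<in> verts G" "z2 \<in> verts G"
      using d adj_in_verts unfolding delta_def by blast+
    have "\<exists>y1 y2 z1 z2. delta (\<lambda>a b. a \<rightarrow> b) x y1 y2 z1 z2 \<and> y1 \<rightarrow> y2 \<and> z1 \<rightarrow> z2"
    proof -
      have sym: "delta (\<lambda>a b. a \<rightarrow> b) x y2 y1 z1 z2" "delta (\<lambda>a b. a \<rightarrow> b) x y1 y2 z2 z1"
        "delta (\<lambda>a b. a \<rightarrow> b) x y2 y1 z2 z1"
        using d by (auto simp: delta_def)
      have "y1 \<rightarrow> y2 \<or> y2 \<rightarrow> y1" "z1 \<rightarrow> z2 \<or> z2 \<rightarrow> z1"
        using d total in_verts by (auto simp: delta_def)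
      then show ?thesis using d sym by blast
    qed
    then obtain y1 y2 z1 z2 where d: "delta (\<lambda>a b. a \<rightarrow> b) x y1 y2 z1 z2" "y1 \<rightarrow> y2" "z1 \<rightarrow> z2"
      by blast
    \<comment> \<open>The order of the list matches the encoding of the vertices by
      \<open>0\<close>, ..., \<open>4\<close>.\<close>
    define g where "g = (!) [x, y1, y2, z1, z2]"
    have arcs: "x \<rightarrow> y1" "x \<rightarrow> y2" "y1 \<rightarrow> z1" "y1 \<rightarrow> z2" "y2 \<rightarrow> z1" "y2 \<rightarrow> z2" "z1 \<rightarrow> x" "z2 \<rightarrow> x"
      "y1 \<rightarrow> y2" "z1 \<rightarrow> z2" using d by (auto simp: delta_def)
    note non_arcs = arcs[THEN asym]
    have sub: "{x, y1, y2, z1, z2} \<subseteq> verts G"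
      using arcs adj_in_verts by blast
    have "distinct [x, y1, y2, z1, z2]"
      using arcs non_arcs by auto
    then have "bij_betw g (verts Delta122) {x, y1, y2, z1, z2}"
      by (auto simp: g_def bij_betw_def vD)
    moreover have "\<forall>a\<in>verts Delta122. \<forall>b\<in>verts Delta122. a \<rightarrow>\<^bsub>Delta122\<^esub> b \<longleftrightarrow> g a \<rightarrow> g b"
      unfolding vD by (simp add: g_def Delta122_def arcs non_arcs irrefl)
    ultimately have "digraph_iso (G \<restriction> {x, y1, y2, z1, z2}) Delta122"
      unfolding digraph_iso_induce_iff[OF D sub] by (intro exI conjI)
    then show ?thesis using sub by blast
  qed
  have "(\<exists>X\<subseteq>verts G. digraph_iso (G \<restriction> X) Delta122)
      \<longleftrightarrow> (\<exists>x y1 y2 z1 z2. delta (\<lambda>a b. a \<rightarrow> b) x y1 y2 z1 z2)"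
    by (intro iffI; elim exE conjE; rule fwd bwd; assumption)
  then show ?thesis unfolding is_free_def contains_def by simp
qed

lemma is_free_induce:
  assumes "is_free G Delta122" and "X \<subseteq> verts G"
  shows "is_free (G \<restriction> X) Delta122"
proof -
  interpret X: tournament "G \<restriction> X" by (rule tournament_induce[OF tournament assms(2)])
  show ?thesis
    using assms(1) unfolding is_free_Delta122_iff X.is_free_Delta122_iff delta_def
    by (simp add: arcs_ends_induce) blast
qed

end


section \<open>One-vertex extensions of the basic tournaments\<close>

text \<open>The arcs are tested as early as possible to keep the evaluations below fast.\<close>

definition has_delta :: "'c set \<Rightarrow> ('c \<Rightarrow> 'c \<Rightarrow> bool) \<Rightarrow> bool" where
  "has_delta V E \<longleftrightarrow> (\<exists>x\<in>V. \<exists>y1\<in>V. E x y1 \<and> (\<exists>y2\<in>V. E x y2 \<and> y1 \<noteq> y2 \<and>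
     (\<exists>z1\<in>V. E y1 z1 \<and> E y2 z1 \<and> E z1 x \<and> (\<exists>z2\<in>V. E y1 z2 \<and> E y2 z2 \<and> E z2 x \<and> z1 \<noteq> z2))))"

lemma has_delta_iff:
  "has_delta V E \<longleftrightarrow> (\<exists>x\<in>V. \<exists>y1\<in>V. \<exists>y2\<in>V. \<exists>z1\<in>V. \<exists>z2\<in>V. delta E x y1 y2 z1 z2)"
  unfolding has_delta_def delta_def by (intro bex_cong refl) blast

text \<open>Adds a vertex \<open>0\<close> with out-neighbourhood \<open>K\<close> and in-neighbourhood the complement of \<open>K\<close>.\<close>

definition ext :: "(int \<Rightarrow> int \<Rightarrow> bool) \<Rightarrow> int set \<Rightarrow> int \<Rightarrow> int \<Rightarrow> bool" where
  "ext E K i j \<longleftrightarrow> (if i = 0 then j \<in> K else if j = 0 then i \<notin> K else E i j)"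

definition rot5 :: "int \<Rightarrow> int \<Rightarrow> bool" where
  "rot5 i j \<longleftrightarrow> (j - i) mod 5 \<in> {1, 2}"

text \<open>One relation for \<open>P7\<close> on \<open>1\<close>, ..., \<open>7\<close> and for
  \<open>P7m\<close> on \<open>1\<close>, ..., \<open>6\<close>. Although \<open>0\<close> and
  \<open>7\<close> agree modulo 7, they do not clash, since \<open>ext\<close> overrides all arcs at
  \<open>0\<close>.\<close>

definition rot7 :: "int \<Rightarrow> int \<Rightarrow> bool" where
  "rot7 i j \<longleftrightarrow> (j - i) mod 7 \<in> {1, 2, 4}"

section \<open>Exhaustive evaluation of one-vertex extensions\<close>

lemma has_delta_ext_rot5:
  "\<forall>K\<in>Pow {1, 2, 3, 4, 5}. has_delta {0, 1, 2, 3, 4, 5} (ext rot5 K) \<or> K \<in> {{}, {1, 2, 3, 4, 5}}"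
  by code_simp

text \<open>\<open>{1, 2, 4}\<close> is the out-neighbourhood of \<open>7\<close> in
  \<open>P7\<close>. Both directions matter: one restricts the vertices outside a given copy of
  \<open>P7m\<close>, the other shows that a vertex attached in a permitted way creates no
  \<Delta>(1,2,2) with the copy.\<close>

lemma has_delta_ext_rot7_iff:
  "\<forall>K\<in>Pow {1, 2, 3, 4, 5, 6}. has_delta {0, 1, 2, 3, 4, 5, 6} (ext rot7 K)
     \<longleftrightarrow> K \<notin> {{}, {1, 2, 4}, {3, 5, 6}, {1, 2, 3, 4, 5, 6}}"
  by code_simp

lemma has_delta_ext_rot7:
  "\<forall>K\<in>Pow {1, 2, 3, 4, 5, 6, 7}. has_delta {0, 1, 2, 3, 4, 5, 6, 7} (ext rot7 K)
     \<or> K \<in> {{}, {1, 2, 3, 4, 5, 6, 7}}"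
  by code_simp

lemma rot5_free: "\<not> has_delta {1, 2, 3, 4, 5} rot5"
  by code_simp

lemma rot7_free: "\<not> has_delta {1, 2, 3, 4, 5, 6, 7} rot7"
  by code_simp


lemma has_delta_image:
  assumes "inj_on h V" and "\<And>i j. i \<in> V \<Longrightarrow> j \<in> V \<Longrightarrow> E (h i) (h j) \<longleftrightarrow> R i j"
  shows "has_delta (h ` V) E \<longleftrightarrow> has_delta V R"
  using assms unfolding has_delta_iff delta_def by (simp add: inj_on_eq_iff cong: bex_cong)

lemma has_delta_mono: "V \<subseteq> W \<Longrightarrow> has_delta V E \<Longrightarrow> has_delta W E"
  unfolding has_delta_iff by blast

section \<open>Copies of \<open>\<Delta>(1,2,2)\<close> and an inserted copy of \<open>P7m\<close>\<close>

definition star_across :: "('c \<Rightarrow> 'c \<Rightarrow> bool) \<Rightarrow> 'c \<Rightarrow> 'c set \<Rightarrow> bool" where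
  "star_across E d Z \<longleftrightarrow>
     (\<exists>a\<in>Z. \<exists>b\<in>Z. \<exists>c\<in>Z. E a d \<and> E d b \<and> E d c \<and> b \<noteq> c \<and> E b a \<and> E c a)
     \<or> (\<exists>a\<in>Z. \<exists>b\<in>Z. \<exists>c\<in>Z. E a d \<and> E c d \<and> E d b \<and> a \<noteq> c \<and> E b a \<and> E b c)"

text \<open>Deleting any vertex \<open>d\<close> from \<open>\<Delta>(1,2,2)\<close> leaves two arcs with a common end going from the
  out-neighbours back to the in-neighbours of \<open>d\<close>; the matching conditions on a bridge forbid this
  unless \<open>P7m\<close> itself supplies these arcs.\<close>

lemma star_across_delta:
  assumes "delta E x y1 y2 z1 z2" and "d \<in> {x, y1, y2, z1, z2}"
  shows "star_across E d {x, y1, y2, z1, z2}"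
proof -
  let ?Z = "{x, y1, y2, z1, z2}"
  have out: "star_across E d ?Z" if "a \<in> ?Z" "b \<in> ?Z" "c \<in> ?Z"
    "E a d" "E d b" "E d c" "b \<noteq> c" "E b a" "E c a" for a b c
    unfolding star_across_def using that by blast
  have inn: "star_across E d ?Z" if "a \<in> ?Z" "b \<in> ?Z" "c \<in> ?Z"
    "E a d" "E c d" "E d b" "a \<noteq> c" "E b a" "E b c" for a b c
    unfolding star_across_def using that by blast
  from assms(2) consider "d = x" | "d = y1" | "d = y2" | "d = z1" | "d = z2" by blast
  then show ?thesis
  proof cases
    case 1 then show ?thesis using assms(1) by (intro out[of z1 y1 y2]) (auto simp: delta_def)
  next
    case 2 then show ?thesis using assms(1) by (intro out[of x z1 z2]) (auto simp: delta_def)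
  next
    case 3 then show ?thesis using assms(1) by (intro out[of x z1 z2]) (auto simp: delta_def)
  next
    case 4 then show ?thesis using assms(1) by (intro inn[of y1 x y2]) (auto simp: delta_def)
  next
    case 5 then show ?thesis using assms(1) by (intro inn[of y1 x y2]) (auto simp: delta_def)
  qed
qed

text \<open>The degree partition of the copy of \<open>P7m\<close> is \<open>(g ` {1, 2, 4}, g ` {3, 5, 6})\<close>, and the arcs
  from the second part to the first are those from \<open>g (7 - i)\<close> to \<open>g i\<close>. Reversing all arcs maps
  \<open>P7m\<close> to itself under \<open>i \<mapsto> 7 - i\<close> and exchanges the two parts.\<close>

locale P7m_inserted =
  fixes V :: "'c set" and E :: "'c \<Rightarrow> 'c \<Rightarrow> bool" and g :: "int \<Rightarrow> 'c" and X :: "'c set"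
  defines "X \<equiv> g ` {1, 2, 3, 4, 5, 6}"
  assumes asym: "E a b \<Longrightarrow> \<not> E b a"
    and total: "a \<in> V \<Longrightarrow> b \<in> V \<Longrightarrow> a \<noteq> b \<Longrightarrow> E a b \<or> E b a"
    and X_subset: "X \<subseteq> V"
    and inj: "inj_on g {1, 2, 3, 4, 5, 6}"
    and arcs: "i \<in> {1, 2, 3, 4, 5, 6} \<Longrightarrow> j \<in> {1, 2, 3, 4, 5, 6} \<Longrightarrow> E (g i) (g j) \<longleftrightarrow> rot7 i j"
    and attached: "w \<in> V - X \<Longrightarrow>
      {i \<in> {1, 2, 3, 4, 5, 6}. E w (g i)} \<in> {{}, {3, 5, 6}, {1, 2, 3, 4, 5, 6}}"
    and matching_D1_tail: "\<lbrakk>a \<in> V - X; b \<in> V - X; b' \<in> V - X; E a (g 1); E (g 1) b; E (g 1) b';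
      E b a; E b' a\<rbrakk> \<Longrightarrow> b = b'"
    and matching_D1_head: "\<lbrakk>a \<in> V - X; a' \<in> V - X; b \<in> V - X; E a (g 1); E a' (g 1); E (g 1) b;
      E b a; E b a'\<rbrakk> \<Longrightarrow> a = a'"
    and matching_D2_tail: "\<lbrakk>a \<in> V - X; b \<in> V - X; b' \<in> V - X; E a (g 3); E (g 3) b; E (g 3) b';
      E b a; E b' a\<rbrakk> \<Longrightarrow> b = b'"
    and matching_D2_head: "\<lbrakk>a \<in> V - X; a' \<in> V - X; b \<in> V - X; E a (g 3); E a' (g 3); E (g 3) b;
      E b a; E b a'\<rbrakk> \<Longrightarrow> a = a'"
begin

lemma in_X: "i \<in> {1, 2, 3, 4, 5, 6} \<Longrightarrow> g i \<in> X"
  unfolding X_def by blast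

text \<open>The three positions of \<open>w\<close> relative to a bridge \<open>uv\<close> in the
  order \<open>v\<close>, \<open>u\<close>: before both, after both, between them. The remaining
  pattern \<open>{1, 2, 4}\<close> would make \<open>u\<close>, \<open>w\<close>, \<open>v\<close> a
  directed path, which a bridge excludes.\<close>

lemma attachedE:
  assumes "w \<in> V - X"
  obtains (above) "\<And>i. i \<in> {1, 2, 3, 4, 5, 6} \<Longrightarrow> E w (g i)"
    | (below) "\<And>i. i \<in> {1, 2, 3, 4, 5, 6} \<Longrightarrow> E (g i) w"
    | (between) "\<And>i. i \<in> {1, 2, 4} \<Longrightarrow> E (g i) w" "\<And>i. i \<in> {3, 5, 6} \<Longrightarrow> E w (g i)"
proof -
  define K where "K = {i \<in> {1, 2, 3, 4, 5, 6}. E w (g i)}"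
  have K: "E w (g i) \<longleftrightarrow> i \<in> K" "E (g i) w \<longleftrightarrow> i \<notin> K" if "i \<in> {1, 2, 3, 4, 5, 6}" for i
  proof -
    show *: "E w (g i) \<longleftrightarrow> i \<in> K" using that by (auto simp: K_def)
    have "g i \<in> V" "w \<noteq> g i" using that in_X X_subset assms by auto
    then show "E (g i) w \<longleftrightarrow> i \<notin> K"
      using * total[of "g i" w] asym[of "g i" w] assms by auto
  qed
  consider "K = {}" | "K = {3, 5, 6}" | "K = {1, 2, 3, 4, 5, 6}"
    using attached[OF assms] unfolding K_def by blast
  then show thesis
  proof cases
    case 1 then show thesis using K by (intro below) simp
  next
    case 2
    have "E (g i) w" if "i \<in> {1, 2, 4}" for i
      using that K(2)[of i] 2 by (elim insertE emptyE) simp_all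
    moreover have "E w (g i)" if "i \<in> {3, 5, 6}" for i
      using that K(1)[of i] 2 by (elim insertE emptyE) simp_all
    ultimately show thesis by (rule between)
  next
    case 3 then show thesis using K by (intro above) simp
  qed
qed

text \<open>The locale states the matching conditions only at the representatives \<open>g 1\<close>
  and \<open>g 3\<close>. As outside vertices do not distinguish members of one part, the conditions
  hold at every member; \<open>attached_D2\<close> is the analogue at \<open>g 3\<close>.\<close>

lemma attached_D1:
  assumes "w \<in> V - X" and "i \<in> {1, 2, 4}"
  shows "E w (g i) \<longleftrightarrow> E w (g 1)" and "E (g i) w \<longleftrightarrow> E (g 1) w"
proof -
  have i: "i \<in> {1, 2, 3, 4, 5, 6}" "1 \<in> {1, 2, 3, 4, 5, 6::int}" "1 \<in> {1, 2, 4::int}"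
    using assms(2) by auto
  show "E w (g i) \<longleftrightarrow> E w (g 1)" "E (g i) w \<longleftrightarrow> E (g 1) w"
    using attachedE[OF assms(1)] i assms(2) asym by metis+
qed

lemma attached_D2:
  assumes "w \<in> V - X" and "i \<in> {3, 5, 6}"
  shows "E w (g i) \<longleftrightarrow> E w (g 3)" and "E (g i) w \<longleftrightarrow> E (g 3) w"
proof -
  have i: "i \<in> {1, 2, 3, 4, 5, 6}" "3 \<in> {1, 2, 3, 4, 5, 6::int}" "3 \<in> {3, 5, 6::int}"
    using assms(2) by auto
  show "E w (g i) \<longleftrightarrow> E w (g 3)" "E (g i) w \<longleftrightarrow> E (g 3) w"
    using attachedE[OF assms(1)] i assms(2) asym by metis+
qed

text \<open>Lets results about the first part be applied to the second. Reversal turns the tail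
  condition of one part into the head condition of the other, exchanges \<open>above\<close> with
  \<open>below\<close>, and preserves \<open>between\<close>.\<close>

lemma reversed: "P7m_inserted V (\<lambda>a b. E b a) (\<lambda>i. g (7 - i))"
proof -
  have flip: "(\<lambda>i. 7 - i) ` {1, 2, 3, 4, 5, 6} = {1, 2, 3, 4, 5, 6::int}" by auto
  then have img: "(\<lambda>i. g (7 - i)) ` {1, 2, 3, 4, 5, 6} = X"
    unfolding X_def image_image[of g "\<lambda>i. 7 - i", symmetric] by (rule arg_cong)
  \<comment> \<open>After reversal the representatives sit at \<open>g 6\<close> and
    \<open>g 4\<close>; uniformity moves them back to \<open>g 3\<close> and
    \<open>g 1\<close>.\<close>
  have D2: "E w (g 6) \<longleftrightarrow> E w (g 3)" "E (g 6) w \<longleftrightarrow> E (g 3) w" if "w \<in> V - X" for w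
    using attached_D2[OF that, of 6] by auto
  have D1: "E w (g 4) \<longleftrightarrow> E w (g 1)" "E (g 4) w \<longleftrightarrow> E (g 1) w" if "w \<in> V - X" for w
    using attached_D1[OF that, of 4] by auto
  show ?thesis
  proof (rule P7m_inserted.intro, unfold img, goal_cases)
    case 4
    have "inj_on (g \<circ> (\<lambda>i. 7 - i)) {1, 2, 3, 4, 5, 6}"
      by (rule comp_inj_on, simp add: inj_on_def, unfold flip, rule inj)
    then show ?case by (simp add: comp_def)
  next
    case (5 i j)
    then have "7 - i \<in> {1, 2, 3, 4, 5, 6}" "7 - j \<in> {1, 2, 3, 4, 5, 6}" by auto
    then show ?case using arcs[of "7 - j" "7 - i"] by (simp add: rot7_def)
  next
    case (6 w)
    from \<open>w \<in> V - X\<close> show ?case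
    proof (cases rule: attachedE)
      case above
      have "\<not> E (g (7 - i)) w" if "i \<in> {1, 2, 3, 4, 5, 6}" for i
        using above[of "7 - i"] asym that by auto
      then have "{i \<in> {1, 2, 3, 4, 5, 6}. E (g (7 - i)) w} = {}" by blast
      then show ?thesis by simp
    next
      case below
      have "E (g (7 - i)) w" if "i \<in> {1, 2, 3, 4, 5, 6}" for i
        using below[of "7 - i"] that by auto
      then have "{i \<in> {1, 2, 3, 4, 5, 6}. E (g (7 - i)) w} = {1, 2, 3, 4, 5, 6}" by blast
      then show ?thesis by simp
    next
      case between
      have *: "\<not> E (g i) w" if "i \<in> {3, 5, 6}" for i
        using asym[OF between(2)[OF that]] .
      have "E (g (7 - i)) w \<longleftrightarrow> i \<in> {3, 5, 6}" if "i \<in> {1, 2, 3, 4, 5, 6}" for i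
        using that by (elim insertE emptyE) (simp_all add: * between(1))
      then have "{i \<in> {1, 2, 3, 4, 5, 6}. E (g (7 - i)) w} = {1, 2, 3, 4, 5, 6} \<inter> {3, 5, 6}" by blast
      then show ?thesis by simp
    qed
  next
    case (7 a b b')
    then show ?case using matching_D2_head[of b b' a] by (simp add: D2)
  next
    case (8 a a' b)
    then show ?case using matching_D2_tail[of b a a'] by (simp add: D2)
  next
    case (9 a b b')
    then show ?case using matching_D1_head[of b b' a] by (simp add: D1)
  next
    case (10 a a' b)
    then show ?case using matching_D1_tail[of b a a'] by (simp add: D1)
  next
    case (1 a b)
    then show ?case by (rule asym)
  next
    case (2 a b)
    then show ?case using total[of b a] by blast
  next
    case 3
    show ?case by (rule X_subset)
  qed
qed

section \<open>Stars across a vertex of the first part\<close>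

text \<open>The first part is the cyclic triangle on \<open>1\<close>, \<open>2\<close>,
  \<open>4\<close> given by doubling modulo 7. As 4 is the inverse of 2, \<open>4 * i mod 7\<close>
  precedes \<open>i\<close> on it; the partner \<open>7 - i\<close> is the only in-neighbour of
  \<open>i\<close> in the second part.\<close>

lemma in_D1:
  assumes "a \<in> V" and "i \<in> {1, 2, 4}" and "E a (g i)"
  obtains "a \<in> V - X" "E a (g 1)" | "a = g (4 * i mod 7)" | "a = g (7 - i)"
proof (cases "a \<in> X")
  case True
  then obtain k where k: "k \<in> {1, 2, 3, 4, 5, 6}" "a = g k" by (auto simp: X_def)
  have "i \<in> {1, 2, 3, 4, 5, 6}" using assms(2) by auto
  then have "rot7 k i" using assms(3) arcs[OF k(1)] k(2) by simp
  then have "k = 4 * i mod 7 \<or> k = 7 - i"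
    using k(1) assms(2) by (elim insertE emptyE) (simp_all add: rot7_def)
  then show thesis using that(2,3) k(2) by auto
next
  case False
  then have "a \<in> V - X" using assms(1) by simp
  then show thesis using that(1) attached_D1(1)[OF _ assms(2)] assms(3) by simp
qed

text \<open>Complementary to \<open>in_D1\<close>: \<open>2 * i mod 7\<close> is the successor on
  the triangle, and within the second part \<open>i\<close> beats all but its partner.\<close>

lemma out_D1:
  assumes "b \<in> V" and "i \<in> {1, 2, 4}" and "E (g i) b"
  obtains "b \<in> V - X" "E (g 1) b" | "b = g (2 * i mod 7)" | j where "j \<in> {3, 5, 6}" "j \<noteq> 7 - i" "b = g j"
proof (cases "b \<in> X")
  case True
  then obtain k where k: "k \<in> {1, 2, 3, 4, 5, 6}" "b = g k" by (auto simp: X_def)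
  have "i \<in> {1, 2, 3, 4, 5, 6}" using assms(2) by auto
  then have "rot7 i k" using assms(3) arcs[OF _ k(1)] k(2) by simp
  then have "k = 2 * i mod 7 \<or> k \<in> {3, 5, 6} \<and> k \<noteq> 7 - i"
    using k(1) assms(2) by (elim insertE emptyE) (simp_all add: rot7_def)
  then show thesis
  proof
    assume "k = 2 * i mod 7"
    then show thesis using k(2) by (intro that(2)) simp
  next
    assume "k \<in> {3, 5, 6} \<and> k \<noteq> 7 - i"
    then show thesis using k(2) by (intro that(3)[of k]) simp_all
  qed
next
  case False
  then have "b \<in> V - X" using assms(1) by simp
  then show thesis using that(1) attached_D1(2)[OF _ assms(2)] assms(3) by simp
qed

text \<open>The only permitted attachment with an arc into the first part has arcs into all of
  \<open>X\<close>.\<close>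

lemma below_X: "a \<in> V - X \<Longrightarrow> E a (g 1) \<Longrightarrow> k \<in> {1, 2, 3, 4, 5, 6} \<Longrightarrow> \<not> E (g k) a"
  by (erule attachedE) (use asym in auto)

text \<open>If the partner is absent, an in-neighbour of \<open>g i\<close> is either an outside
  vertex dominating \<open>X\<close> or the predecessor on the triangle. A star using the former has
  all its ends outside, against a matching condition. The latter can only receive two arcs, and
  their tails put the whole triangle and a vertex of the second part into \<open>Z\<close>.\<close>

lemma star_across_D1:
  assumes Z: "Z \<subseteq> V" and i: "i \<in> {1, 2, 4}" "g i \<in> Z" and star: "star_across E (g i) Z"
  shows "g (7 - i) \<in> Z \<or> {g 1, g 2, g 4} \<subseteq> Z \<and> (\<exists>j\<in>{3, 5, 6}. g j \<in> Z)"
proof (rule disjCI, rule ccontr)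
  assume not_four: "\<not> ({g 1, g 2, g 4} \<subseteq> Z \<and> (\<exists>j\<in>{3, 5, 6}. g j \<in> Z))"
    and not_match: "g (7 - i) \<notin> Z"
  have gi: "4 * i mod 7 \<in> {1, 2, 4}" "2 * i mod 7 \<in> {1, 2, 4}" using i(1) by auto
  \<comment> \<open>Since \<open>a\<close> dominates \<open>X\<close>, no vertex of \<open>X\<close>
    sends an arc back to \<open>a\<close>.\<close>
  have outside: "b \<in> V - X" "E (g 1) b"
    if "a \<in> V - X" "E a (g 1)" "b \<in> Z" "E (g i) b" "E b a" for a b
  proof -
    have "b \<noteq> g k" if "k \<in> {1, 2, 3, 4, 5, 6}" for k
      using below_X[of a k] \<open>a \<in> V - X\<close> \<open>E a (g 1)\<close> \<open>E b a\<close> that by blast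
    then have "b \<notin> X" by (auto simp: X_def)
    then show "b \<in> V - X" using that Z by blast
    then show "E (g 1) b" using attached_D1[of b i] i(1) that by blast
  qed
  \<comment> \<open>An outside vertex treats the triangle uniformly, so it cannot lie after
    \<open>g 1\<close> and before another member.\<close>
  have pred_outside: False if "b \<in> V - X" "E (g 1) b" "E b (g (4 * i mod 7))" for b
    using that attached_D1[of b "4 * i mod 7"] gi asym by blast
  show False
    using star unfolding star_across_def
  proof (elim disjE bexE conjE)
    fix a b c
    assume abc: "a \<in> Z" "b \<in> Z" "c \<in> Z" "E a (g i)" "E (g i) b" "E (g i) c" "b \<noteq> c" "E b a" "E c a"
    have "a \<in> V" "b \<in> V" "c \<in> V" using abc Z by auto
    from \<open>a \<in> V\<close> i(1) \<open>E a (g i)\<close> show False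
    proof (cases rule: in_D1)
      case 1
      then show False using outside abc matching_D1_tail[of a b c] by blast
    next
      case 3
      then show False using abc not_match by blast
    next
      case 2
      have kind: "b = g (2 * i mod 7) \<or> b = g (7 - 4 * i mod 7)"
        if b: "b \<in> Z" "E (g i) b" "E b a" for b
      proof -
        have "b \<in> V" using b Z by blast
        from this i(1) \<open>E (g i) b\<close> show ?thesis
        proof (cases rule: out_D1)
          case 1
          then show ?thesis using pred_outside b \<open>a = g (4 * i mod 7)\<close> by blast
        next
          case (3 j)
          \<comment> \<open>Within the second part, only the partner of the predecessor has an arc
            to it.\<close>
          have "rot7 j (4 * i mod 7)" using 3 b 2 arcs[of j "4 * i mod 7"] gi by auto
          then have "j = 7 - 4 * i mod 7" using 3 i by (auto simp: rot7_def)
          then show ?thesis using 3 by blast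
        qed blast
      qed
      \<comment> \<open>\<open>b\<close> and \<open>c\<close> are distinct and only two values are
        possible, so both values occur.\<close>
      have "{b, c} = {g (2 * i mod 7), g (7 - 4 * i mod 7)}"
        using kind[of b] kind[of c] abc by blast
      then have "g (2 * i mod 7) \<in> Z" "g (7 - 4 * i mod 7) \<in> Z" "g (4 * i mod 7) \<in> Z"
        using abc 2 by (auto simp: doubleton_eq_iff)
      then show False using i not_four by (elim insertE emptyE) simp_all
    qed
  next
    fix a b c
    assume abc: "a \<in> Z" "b \<in> Z" "c \<in> Z" "E a (g i)" "E c (g i)" "E (g i) b" "a \<noteq> c" "E b a" "E b c"
    have V: "a \<in> V" "b \<in> V" "c \<in> V" using abc Z by auto
    from V(1) i(1) abc(4) show False
    proof (cases rule: in_D1)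
      case 1
      note a = 1 and b = outside[OF 1 abc(2,6,8)]
      from V(3) i(1) abc(5) show False
      proof (cases rule: in_D1)
        case 1
        then show False using a b abc matching_D1_head[of a c b] by blast
      next
        case 2
        then show False using b pred_outside abc by blast
      next
        case 3
        then show False using abc not_match by blast
      qed
    next
      case 2
      note a = 2
      from V(3) i(1) abc(5) show False
      proof (cases rule: in_D1)
        case 1
        then show False using outside[OF 1 abc(2,6,9)] a pred_outside abc by blast
      next
        case 2
        then show False using a abc by blast
      next
        case 3
        then show False using abc not_match by blast
      qed
    next
      case 3
      then show False using abc not_match by blast
    qed
  qed
qed

end


section \<open>\<Delta>(1,2,2) across an inserted copy\<close>

text \<open>Renames \<open>w\<close> to \<open>0\<close> and \<open>g i\<close> to \<open>i\<close>,
  which reduces a vertex next to a copy to one of the evaluated extensions.\<close>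

lemma has_delta_ext:
  assumes "inj_on g I" and "0 \<notin> I" and "w \<notin> g ` I" and "\<not> E w w"
    and "\<And>i j. i \<in> I \<Longrightarrow> j \<in> I \<Longrightarrow> E (g i) (g j) \<longleftrightarrow> R i j"
    and "\<And>i. i \<in> I \<Longrightarrow> E (g i) w \<longleftrightarrow> \<not> E w (g i)"
  shows "has_delta (insert w (g ` I)) E \<longleftrightarrow> has_delta (insert 0 I) (ext R {i \<in> I. E w (g i)})"
proof -
  define h where "h i = (if i = 0 then w else g i)" for i
  have h: "h i = g i" if "i \<in> I" for i using that assms(2) by (auto simp: h_def)
  have "insert w (g ` I) = h ` insert 0 I"
    using h by (simp add: h_def[of 0])
  moreover have "has_delta (h ` insert 0 I) E
      \<longleftrightarrow> has_delta (insert 0 I) (ext R {i \<in> I. E w (g i)})"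
  proof (rule has_delta_image)
    show "inj_on h (insert 0 I)"
      using assms(1,3) h by (auto simp: inj_on_def h_def[of 0])
    show "E (h i) (h j) \<longleftrightarrow> ext R {i \<in> I. E w (g i)} i j"
      if "i \<in> insert 0 I" "j \<in> insert 0 I" for i j
      using that assms(2,4,5,6) by (auto simp: h_def ext_def)
  qed
  ultimately show ?thesis by simp
qed

context P7m_inserted
begin

text \<open>The permitted attachments are among those that the evaluation found harmless. If
  \<open>w\<close> lies in \<open>X\<close>, the claim is that \<open>P7m\<close> is free, which it
  inherits from \<open>P7\<close>.\<close>

lemma no_delta_with_one_outside:
  assumes "w \<in> V"
  shows "\<not> has_delta (insert w X) E"
proof
  assume has: "has_delta (insert w X) E"
  have "has_delta X E \<longleftrightarrow> has_delta {1, 2, 3, 4, 5, 6} rot7"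
    unfolding X_def by (rule has_delta_image) (fact inj, rule arcs)
  then have "\<not> has_delta X E"
    using rot7_free has_delta_mono[of "{1, 2, 3, 4, 5, 6}" "{1, 2, 3, 4, 5, 6, 7}" rot7] by blast
  then have w: "w \<in> V - X" using has assms by (auto simp: insert_absorb)
  define K where "K = {i \<in> {1, 2, 3, 4, 5, 6}. E w (g i)}"
  have comparable: "E (g i) w \<longleftrightarrow> \<not> E w (g i)" if "i \<in> {1, 2, 3, 4, 5, 6}" for i
  proof -
    have "g i \<in> V" "g i \<noteq> w" using in_X[OF that] X_subset w by auto
    then show ?thesis using total[of "g i" w] asym[of "g i" w] w by blast
  qed
  have "has_delta (insert w (g ` {1, 2, 3, 4, 5, 6})) E
      \<longleftrightarrow> has_delta (insert 0 {1, 2, 3, 4, 5, 6}) (ext rot7 K)"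
    unfolding K_def
  proof (rule has_delta_ext)
    show "w \<notin> g ` {1, 2, 3, 4, 5, 6}" using w unfolding X_def by blast
    show "\<not> E w w" using asym by blast
  qed (fact inj, simp, fact arcs, fact comparable)
  then have "has_delta (insert 0 {1, 2, 3, 4, 5, 6}) (ext rot7 K)"
    using has unfolding X_def by blast
  moreover have "K \<in> Pow {1, 2, 3, 4, 5, 6}" by (auto simp: K_def)
  ultimately have "K \<notin> {{}, {1, 2, 4}, {3, 5, 6}, {1, 2, 3, 4, 5, 6}}"
    using has_delta_ext_rot7_iff by blast
  then show False using attached[OF w, folded K_def] by (elim insertE emptyE) simp_all
qed

text \<open>By the preceding lemma no four of the five vertices lie in \<open>X\<close>. This
  excludes the second alternative of \<open>star_across_D1\<close>, so each of the vertices in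
  \<open>X\<close> brings its partner along, and two partner pairs would again make four.\<close>

lemma delta_meets_one_pair:
  assumes delta: "delta E x y1 y2 z1 z2" and V: "{x, y1, y2, z1, z2} \<subseteq> V"
  shows "\<exists>i\<in>{1, 2, 4}. {x, y1, y2, z1, z2} \<inter> X \<subseteq> {g i, g (7 - i)}"
proof -
  define Z where "Z = {x, y1, y2, z1, z2}"
  have Z: "Z \<subseteq> V" "finite Z" using V by (auto simp: Z_def)
  have "has_delta Z E" using delta unfolding has_delta_iff Z_def by blast
  then have two_outside: "\<not> Z \<subseteq> insert w X" if "w \<in> V" for w
    using no_delta_with_one_outside[OF that] has_delta_mono by blast
  have "card Z \<le> 5" unfolding Z_def by (simp add: card_insert_if)
  \<comment> \<open>Besides four vertices of \<open>X\<close> the set \<open>Z\<close> has room for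
    one more, so it would lie in \<open>X\<close> plus a single vertex.\<close>
  have few: False if S: "S \<subseteq> Z \<inter> X" "card S = 4" for S
  proof -
    have "card (Z - S) = card Z - 4"
      using S Z(2) by (subst card_Diff_subset) (auto intro: finite_subset)
    then have "card (Z - S) \<le> 1" using \<open>card Z \<le> 5\<close> by simp
    then have *: "\<forall>a\<in>Z - S. \<forall>b\<in>Z - S. a = b" using Z(2) by (simp add: card_le_Suc0_iff_eq)
    have "x \<in> Z" by (simp add: Z_def)
    with two_outside[of x] Z obtain w where "w \<in> Z - X" by blast
    then have "Z \<subseteq> insert w X" using * S(1) by blast
    then show False using two_outside \<open>w \<in> Z - X\<close> Z by blast
  qed
  have inj_iff: "g i = g j \<longleftrightarrow> i = j" if "i \<in> {1, 2, 3, 4, 5, 6}" "j \<in> {1, 2, 3, 4, 5, 6}" for i j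
    by (rule inj_on_eq_iff[OF inj that])
  interpret rev: P7m_inserted V "\<lambda>a b. E b a" "\<lambda>i. g (7 - i)" "(\<lambda>i. g (7 - i)) ` {1, 2, 3, 4, 5, 6}"
    by (rule reversed)
  have star: "star_across E d Z" "star_across (\<lambda>a b. E b a) d Z" if "d \<in> Z" for d
  proof -
    show "star_across E d Z"
      using star_across_delta[OF delta] that unfolding Z_def by blast
    \<comment> \<open>Reversing all arcs exchanges the two alternatives of
      \<open>star_across\<close>.\<close>
    then show "star_across (\<lambda>a b. E b a) d Z" unfolding star_across_def by blast
  qed
  have closed_D1: "g (7 - i) \<in> Z" if i: "i \<in> {1, 2, 4}" "g i \<in> Z" for i
  proof (rule ccontr)
    assume "g (7 - i) \<notin> Z"
    then obtain j where j: "{g 1, g 2, g 4} \<subseteq> Z" "j \<in> {3, 5, 6}" "g j \<in> Z"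
      using star_across_D1[OF Z(1) i star(1)[OF i(2)]] by blast
    have "card {g 1, g 2, g 4, g j} = 4"
      using j(2) by (elim insertE emptyE) (simp_all add: inj_iff)
    moreover have "{g 1, g 2, g 4, g j} \<subseteq> Z \<inter> X"
      using j by (auto simp: X_def)
    ultimately show False by (rule few[rotated])
  qed
  have closed_D2: "g (7 - i) \<in> Z" if i: "i \<in> {3, 5, 6}" "g i \<in> Z" for i
  proof (rule ccontr)
    assume no: "g (7 - i) \<notin> Z"
    \<comment> \<open>In the reversed instance the index \<open>7 - i\<close> names
      \<open>g i\<close>, which there belongs to the first part.\<close>
    have i': "7 - i \<in> {1, 2, 4}" "g (7 - (7 - i)) \<in> Z" using i by auto
    have "{g 6, g 5, g 3} \<subseteq> Z \<and> (\<exists>j\<in>{3, 5, 6}. g (7 - j) \<in> Z)"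
      using rev.star_across_D1[OF Z(1) i' star(2)[OF i'(2)]] no by simp
    then obtain j where j: "{g 6, g 5, g 3} \<subseteq> Z" "j \<in> {3, 5, 6}" "g (7 - j) \<in> Z"
      by blast
    have "card {g 6, g 5, g 3, g (7 - j)} = 4"
      using j(2) by (elim insertE emptyE) (simp_all add: inj_iff)
    moreover have "{g 6, g 5, g 3, g (7 - j)} \<subseteq> Z \<inter> X"
      using j by (auto simp: X_def)
    ultimately show False by (rule few[rotated])
  qed
  have unique: "i = j" if "i \<in> {1, 2, 4}" "j \<in> {1, 2, 4}" "g i \<in> Z" "g j \<in> Z" for i j
  proof (rule ccontr)
    assume "i \<noteq> j"
    with that(1,2) have "card {g i, g j, g (7 - i), g (7 - j)} = 4"
      by (elim insertE emptyE) (simp_all add: inj_iff)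
    moreover have "{g i, g j, g (7 - i), g (7 - j)} \<subseteq> Z \<inter> X"
    proof (rule Int_greatest)
      show "{g i, g j, g (7 - i), g (7 - j)} \<subseteq> Z"
        using that closed_D1 by simp
      show "{g i, g j, g (7 - i), g (7 - j)} \<subseteq> X"
        using that(1,2) by (intro insert_subsetI empty_subsetI in_X) auto
    qed
    ultimately show False by (rule few[rotated])
  qed
  have cover: "\<exists>i\<in>{1, 2, 4}. g i \<in> Z \<and> a \<in> {g i, g (7 - i)}" if a: "a \<in> Z \<inter> X" for a
  proof -
    from a obtain k where k: "k \<in> {1, 2, 3, 4, 5, 6}" "a = g k" by (auto simp: X_def)
    then consider "k \<in> {1, 2, 4}" | "k \<in> {3, 5, 6}" by blast
    then show ?thesis
    proof cases
      case 1
      then show ?thesis using a k by blast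
    next
      case 2
      then have "7 - k \<in> {1, 2, 4}" "g (7 - k) \<in> Z" using a k closed_D2 by auto
      then show ?thesis using k(2) by (intro bexI[of _ "7 - k"]) auto
    qed
  qed
  show ?thesis
  proof (cases "\<exists>i\<in>{1, 2, 4}. g i \<in> Z")
    case True
    then obtain i where i: "i \<in> {1, 2, 4}" "g i \<in> Z" by blast
    have "Z \<inter> X \<subseteq> {g i, g (7 - i)}"
    proof
      fix a assume "a \<in> Z \<inter> X"
      from cover[OF this] obtain j where j: "j \<in> {1, 2, 4}" "g j \<in> Z" "a \<in> {g j, g (7 - j)}"
        by (elim bexE conjE)
      from unique[OF i(1) j(1) i(2) j(2)] j(3) show "a \<in> {g i, g (7 - i)}" by simp
    qed
    then show ?thesis using i(1) unfolding Z_def by blast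
  next
    case False
    then have "Z \<inter> X = {}" using cover by blast
    then show ?thesis unfolding Z_def by blast
  qed
qed

end


section \<open>Basic tournaments\<close>

lemma atLeastAtMost_5_6_7:
  "{1..5::int} = {1, 2, 3, 4, 5}" "{1..6::int} = {1, 2, 3, 4, 5, 6}" "{1..7::int} = {1, 2, 3, 4, 5, 6, 7}"
  by auto

lemma verts_basic: "verts T5 = {1, 2, 3, 4, 5}" "verts P7 = {1, 2, 3, 4, 5, 6, 7}"
  "verts P7m = {1, 2, 3, 4, 5, 6}"
  by (auto simp: T5_def P7_def P7m_def pre_digraph.del_vert_def atLeastAtMost_5_6_7)

lemma arcs_ends_T5: "i \<rightarrow>\<^bsub>T5\<^esub> j \<longleftrightarrow> i \<in> verts T5 \<and> j \<in> verts T5 \<and> rot5 i j"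
  by (simp add: T5_def rot5_def)

lemma arcs_ends_P7: "i \<rightarrow>\<^bsub>P7\<^esub> j \<longleftrightarrow> i \<in> verts P7 \<and> j \<in> verts P7 \<and> rot7 i j"
  by (simp add: P7_def rot7_def)

lemma P7m_eq: "P7m = with_proj \<lparr> pverts = {1, 2, 3, 4, 5, 6},
    parcs = {(i, j). i \<in> {1, 2, 3, 4, 5, 6} \<and> j \<in> {1, 2, 3, 4, 5, 6} \<and> rot7 i j} \<rparr>"
proof -
  have *: "i \<in> {1..7} \<and> i \<noteq> 7 \<longleftrightarrow> i \<in> {1..6}" for i :: int by auto
  have "{1..7} - {7} = {1..6::int}" by auto
  moreover have "{e \<in> {(i, j). i \<in> {1..7} \<and> j \<in> {1..7} \<and> (j - i) mod 7 \<in> {1, 2, 4}}.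
      fst e \<noteq> 7 \<and> snd e \<noteq> 7} = {(i, j). i \<in> {1..6} \<and> j \<in> {1..6::int} \<and> rot7 i j}"
    unfolding *[symmetric] rot7_def by auto
  ultimately show ?thesis
    unfolding atLeastAtMost_5_6_7(2)[symmetric]
    by (simp add: P7m_def P7_def pre_digraph.del_vert_def with_proj_def)
qed

lemma arcs_ends_P7m: "i \<rightarrow>\<^bsub>P7m\<^esub> j \<longleftrightarrow> i \<in> verts P7m \<and> j \<in> verts P7m \<and> rot7 i j"
  unfolding verts_basic by (simp add: P7m_eq)

lemma rot5_tournament: "\<forall>i\<in>{1, 2, 3, 4, 5}. \<forall>j\<in>{1, 2, 3, 4, 5}. rot5 i j \<longleftrightarrow> i \<noteq> j \<and> \<not> rot5 j i"
  by code_simp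

lemma rot7_tournament:
  "\<forall>i\<in>{1, 2, 3, 4, 5, 6, 7}. \<forall>j\<in>{1, 2, 3, 4, 5, 6, 7}. rot7 i j \<longleftrightarrow> i \<noteq> j \<and> \<not> rot7 j i"
  by code_simp

lemma tournament_T5: "tournament T5"
  unfolding T5_def atLeastAtMost_5_6_7
proof (rule tournament_with_proj)
  fix i j :: int assume "i \<in> {1, 2, 3, 4, 5}" "j \<in> {1, 2, 3, 4, 5}" "i \<noteq> j"
  then show "(i, j) \<in> {(i, j). i \<in> {1, 2, 3, 4, 5} \<and> j \<in> {1, 2, 3, 4, 5} \<and> (j - i) mod 5 \<in> {1, 2}}
    \<longleftrightarrow> (j, i) \<notin> {(i, j). i \<in> {1, 2, 3, 4, 5} \<and> j \<in> {1, 2, 3, 4, 5} \<and> (j - i) mod 5 \<in> {1, 2}}"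
    using rot5_tournament[THEN bspec, THEN bspec, of i j] by (simp add: rot5_def)
qed (simp, blast, simp)

lemma tournament_P7: "tournament P7"
  unfolding P7_def atLeastAtMost_5_6_7
proof (rule tournament_with_proj)
  fix i j :: int assume "i \<in> {1, 2, 3, 4, 5, 6, 7}" "j \<in> {1, 2, 3, 4, 5, 6, 7}" "i \<noteq> j"
  then show "(i, j) \<in> {(i, j). i \<in> {1, 2, 3, 4, 5, 6, 7} \<and> j \<in> {1, 2, 3, 4, 5, 6, 7} \<and> (j - i) mod 7 \<in> {1, 2, 4}}
    \<longleftrightarrow> (j, i) \<notin> {(i, j). i \<in> {1, 2, 3, 4, 5, 6, 7} \<and> j \<in> {1, 2, 3, 4, 5, 6, 7} \<and> (j - i) mod 7 \<in> {1, 2, 4}}"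
    using rot7_tournament[THEN bspec, THEN bspec, of i j] by (simp add: rot7_def)
qed (simp, blast, simp)

lemma tournament_P7m: "tournament P7m"
  unfolding P7m_eq
proof (rule tournament_with_proj)
  fix i j :: int assume "i \<in> {1, 2, 3, 4, 5, 6}" "j \<in> {1, 2, 3, 4, 5, 6}" "i \<noteq> j"
  then show "(i, j) \<in> {(i, j). i \<in> {1, 2, 3, 4, 5, 6} \<and> j \<in> {1, 2, 3, 4, 5, 6} \<and> rot7 i j}
    \<longleftrightarrow> (j, i) \<notin> {(i, j). i \<in> {1, 2, 3, 4, 5, 6} \<and> j \<in> {1, 2, 3, 4, 5, 6} \<and> rot7 i j}"
    using rot7_tournament[THEN bspec, THEN bspec, of i j] by simp metis
qed (simp, blast, simp add: rot7_def)

lemma basic_tournament: "S \<in> basic_tournaments \<Longrightarrow> tournament S"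
  by (auto simp: basic_tournaments_def tournament_T5 tournament_P7 tournament_P7m)

lemma (in tournament) is_free_iff_has_delta:
  "is_free G Delta122 \<longleftrightarrow> \<not> has_delta (verts G) (\<lambda>a b. a \<rightarrow> b)"
proof -
  have "x \<in> verts G \<and> y1 \<in> verts G \<and> y2 \<in> verts G \<and> z1 \<in> verts G \<and> z2 \<in> verts G"
    if "delta (\<lambda>a b. a \<rightarrow> b) x y1 y2 z1 z2" for x y1 y2 z1 z2
    using that adj_in_verts unfolding delta_def by blast
  then show ?thesis unfolding is_free_Delta122_iff has_delta_iff by blast
qed

lemma basic_free:
  assumes "S \<in> basic_tournaments"
  shows "\<not> delta (\<lambda>a b. a \<rightarrow>\<^bsub>S\<^esub> b) x y1 y2 z1 z2"
proof -
  interpret tournament S by (rule basic_tournament[OF assms])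
  have cong: "has_delta (verts S) (\<lambda>a b. a \<rightarrow>\<^bsub>S\<^esub> b) \<longleftrightarrow> has_delta (verts S) R"
    if "\<And>i j. i \<in> verts S \<Longrightarrow> j \<in> verts S \<Longrightarrow> i \<rightarrow>\<^bsub>S\<^esub> j \<longleftrightarrow> R i j" for R
    using has_delta_image[of id "verts S" "\<lambda>a b. a \<rightarrow>\<^bsub>S\<^esub> b" R] that by simp
  have "\<not> has_delta {1, 2, 3, 4, 5, 6} rot7"
    using rot7_free has_delta_mono[of "{1, 2, 3, 4, 5, 6}" "{1, 2, 3, 4, 5, 6, 7}" rot7] by auto
  note rot7_free' = this
  consider "S = T5" | "S = P7m" | "S = P7"
    using assms by (auto simp: basic_tournaments_def)
  then have "\<not> has_delta (verts S) (\<lambda>a b. a \<rightarrow>\<^bsub>S\<^esub> b)"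
  proof cases
    case 1 then show ?thesis using cong[of rot5] rot5_free arcs_ends_T5 verts_basic by simp
  next
    case 2 then show ?thesis using cong[of rot7] rot7_free' arcs_ends_P7m verts_basic by simp
  next
    case 3 then show ?thesis using cong[of rot7] rot7_free arcs_ends_P7 verts_basic by simp
  qed
  then show ?thesis using is_free_iff_has_delta is_free_Delta122_iff by blast
qed

section \<open>The degree partition of \<open>P7m\<close>\<close>

text \<open>\<open>out_degree\<close> counts arcs; without parallel arcs, those leaving
  \<open>a\<close> correspond to their heads.\<close>

lemma (in digraph) out_degree_eq_card: "out_degree G a = card {b. a \<rightarrow> b}"
proof -
  have "inj_on (head G) (out_arcs G a)"
    by (rule inj_onI, rule no_multi_arcs) (auto simp: arc_to_ends_def)
  moreover have "head G ` out_arcs G a = {b. a \<rightarrow> b}"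
    by (auto simp: arcs_ends_conv image_iff)
  ultimately show ?thesis unfolding out_degree_def by (metis card_image)
qed

text \<open>All out-degrees in \<open>P7\<close> are 3, and deleting \<open>7\<close> costs one to
  each of its in-neighbours \<open>3\<close>, \<open>5\<close>, \<open>6\<close>.\<close>

lemma rot7_out_degree:
  "\<forall>i\<in>{1, 2, 3, 4, 5, 6}. card (Set.filter (rot7 i) {1, 2, 3, 4, 5, 6}) = (if i \<in> {1, 2, 4} then 3 else 2)"
  by code_simp

text \<open>Stated for an arbitrary copy, since it is applied both to \<open>P7m\<close> itself, for
  the join, and to an induced copy in a larger tournament.\<close>

lemma degree_partition:
  assumes "tournament S" and "bij_betw g {1, 2, 3, 4, 5, 6} (verts S)"
    and arcs: "\<And>i j. i \<in> {1, 2, 3, 4, 5, 6} \<Longrightarrow> j \<in> {1, 2, 3, 4, 5, 6} \<Longrightarrow> g i \<rightarrow>\<^bsub>S\<^esub> g j \<longleftrightarrow> rot7 i j"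
  shows "D1 S = g ` {1, 2, 4}" and "D2 S = g ` {3, 5, 6}"
proof -
  interpret tournament S by fact
  have verts: "verts S = g ` {1, 2, 3, 4, 5, 6}" and inj: "inj_on g {1, 2, 3, 4, 5, 6}"
    using assms(2) by (auto simp: bij_betw_def)
  have deg: "out_degree S (g i) = (if i \<in> {1, 2, 4} then 3 else 2)" if i: "i \<in> {1, 2, 3, 4, 5, 6}" for i
  proof -
    have "{b. g i \<rightarrow>\<^bsub>S\<^esub> b} = g ` Set.filter (rot7 i) {1, 2, 3, 4, 5, 6}"
    proof (intro equalityI subsetI)
      fix b assume "b \<in> {b. g i \<rightarrow>\<^bsub>S\<^esub> b}"
      then have "g i \<rightarrow>\<^bsub>S\<^esub> b" by simp
      moreover from this have "b \<in> g ` {1, 2, 3, 4, 5, 6}" using verts adj_in_verts by metis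
      then obtain j where "j \<in> {1, 2, 3, 4, 5, 6}" "b = g j" by (rule imageE)
      ultimately show "b \<in> g ` Set.filter (rot7 i) {1, 2, 3, 4, 5, 6}"
        using arcs[OF i] by (intro image_eqI[of _ _ j]) simp_all
    next
      fix b assume "b \<in> g ` Set.filter (rot7 i) {1, 2, 3, 4, 5, 6}"
      then obtain j where "j \<in> {1, 2, 3, 4, 5, 6}" "rot7 i j" "b = g j" by auto
      then show "b \<in> {b. g i \<rightarrow>\<^bsub>S\<^esub> b}" using arcs[OF i] by simp
    qed
    moreover have "inj_on g (Set.filter (rot7 i) {1, 2, 3, 4, 5, 6})"
      by (rule inj_on_subset[OF inj]) auto
    ultimately show ?thesis
      using rot7_out_degree i by (simp only: out_degree_eq_card card_image)
  qed
  have deg3: "out_degree S (g i) = 3 \<longleftrightarrow> i \<in> {1, 2, 4}" and deg2: "out_degree S (g i) = 2 \<longleftrightarrow> i \<notin> {1, 2, 4}"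
    if "i \<in> {1, 2, 3, 4, 5, 6}" for i
    unfolding deg[OF that] by presburger+
  have "D1 S = {w \<in> verts S. out_degree S w = 3}" by (rule D1_def)
  also have "\<dots> = g ` {i \<in> {1, 2, 3, 4, 5, 6}. out_degree S (g i) = 3}" unfolding verts by (rule Compr_image_eq)
  also have "{i \<in> {1, 2, 3, 4, 5, 6}. out_degree S (g i) = 3} = {1, 2, 3, 4, 5, 6} \<inter> {1, 2, 4}"
    using deg3 by blast
  finally show "D1 S = g ` {1, 2, 4}" by simp
  have "D2 S = {w \<in> verts S. out_degree S w = 2}" by (rule D2_def)
  also have "\<dots> = g ` {i \<in> {1, 2, 3, 4, 5, 6}. out_degree S (g i) = 2}" unfolding verts by (rule Compr_image_eq)
  also have "{i \<in> {1, 2, 3, 4, 5, 6}. out_degree S (g i) = 2} = {1, 2, 3, 4, 5, 6} - {1, 2, 4}"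
    using deg2 by blast
  also have "\<dots> = {3, 5, 6}" by (simp add: insert_Diff_if)
  finally show "D2 S = g ` {3, 5, 6}" .
qed

lemma degree_partition_P7m: "D1 P7m = {1, 2, 4}" "D2 P7m = {3, 5, 6}"
proof -
  have "bij_betw (\<lambda>i. i) {1, 2, 3, 4, 5, 6} (verts P7m)"
    unfolding verts_basic by (simp add: bij_betw_def)
  from degree_partition[OF tournament_P7m this] show "D1 P7m = {1, 2, 4}" "D2 P7m = {3, 5, 6}"
    by (simp_all add: arcs_ends_P7m verts_basic)
qed


section \<open>Homogeneity\<close>

context tournament
begin

text \<open>Connects freeness of \<open>G\<close> with the evaluations: \<open>ext\<close> models
  the copy together with \<open>w\<close>, whose out-neighbours in the copy form the set passed to
  it.\<close>

lemma no_delta_ext: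
  assumes "is_free G Delta122" and "inj_on g I" and "g ` I \<subseteq> verts G" and "0 \<notin> I"
    and "\<And>i j. i \<in> I \<Longrightarrow> j \<in> I \<Longrightarrow> g i \<rightarrow> g j \<longleftrightarrow> R i j"
    and w: "w \<in> verts G - g ` I"
  shows "\<not> has_delta (insert 0 I) (ext R {i \<in> I. w \<rightarrow> g i})"
proof -
  have "g i \<rightarrow> w \<longleftrightarrow> \<not> w \<rightarrow> g i" if "i \<in> I" for i
    using exactly_one_arc[of "g i" w] that assms(3) w by blast
  then have "has_delta (insert w (g ` I)) (\<lambda>a b. a \<rightarrow> b)
      \<longleftrightarrow> has_delta (insert 0 I) (ext R {i \<in> I. w \<rightarrow> g i})"
    using w irrefl assms(2,4,5) by (intro has_delta_ext) auto
  moreover have "\<not> has_delta (insert w (g ` I)) (\<lambda>a b. a \<rightarrow> b)"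
    using assms(1,3) w has_delta_mono[of "insert w (g ` I)" "verts G"]
    unfolding is_free_iff_has_delta by auto
  ultimately show ?thesis by simp
qed

lemma homogeneous_setI:
  assumes "I \<noteq> {}" and "g ` I \<subseteq> verts G"
    and K: "\<And>w. w \<in> verts G - g ` I \<Longrightarrow> {i \<in> I. w \<rightarrow> g i} \<in> {{}, I}"
  shows "homogeneous_set G (g ` I)"
  unfolding homogeneous_set_def
proof (intro conjI ballI)
  fix w assume w: "w \<in> verts G - g ` I"
  from K[OF w] consider "{i \<in> I. w \<rightarrow> g i} = {}" | "{i \<in> I. w \<rightarrow> g i} = I" by blast
  then show "all_arcs_to G {w} (g ` I) \<or> all_arcs_to G (g ` I) {w}"
  proof cases
    case 1
    have "g i \<rightarrow> w" if "i \<in> I" for i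
      using exactly_one_arc[of "g i" w] that 1 assms(2) w by blast
    then show ?thesis by (auto simp: all_arcs_to_def)
  next
    case 2
    then show ?thesis by (auto simp: all_arcs_to_def)
  qed
qed (use assms in auto)

lemma homogeneous_set_T5:
  assumes "is_free G Delta122" and "X \<subseteq> verts G" and "digraph_iso (G \<restriction> X) T5"
  shows "homogeneous_set G X"
proof -
  interpret T5: tournament T5 by (rule tournament_T5)
  obtain g where g: "bij_betw g (verts T5) X"
    "\<forall>i\<in>verts T5. \<forall>j\<in>verts T5. i \<rightarrow>\<^bsub>T5\<^esub> j \<longleftrightarrow> g i \<rightarrow> g j"
    using assms(3) unfolding digraph_iso_induce_iff[OF T5.nomulti_digraph assms(2)] by (elim exE conjE)
  have X: "X = g ` verts T5" and inj: "inj_on g (verts T5)"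
    using g(1) by (auto simp: bij_betw_def)
  have arcs: "g i \<rightarrow> g j \<longleftrightarrow> rot5 i j" if "i \<in> verts T5" "j \<in> verts T5" for i j
    using g(2) that by (simp add: arcs_ends_T5)
  show ?thesis
    unfolding X
  proof (rule homogeneous_setI)
    fix w assume w: "w \<in> verts G - g ` verts T5"
    have "\<not> has_delta (insert 0 (verts T5)) (ext rot5 {i \<in> verts T5. w \<rightarrow> g i})"
      using assms(1) inj _ _ arcs w
      by (rule no_delta_ext) (use assms(2) X in \<open>auto simp: verts_basic\<close>)
    moreover have "{i \<in> verts T5. w \<rightarrow> g i} \<in> Pow {1, 2, 3, 4, 5}" unfolding verts_basic by blast
    ultimately show "{i \<in> verts T5. w \<rightarrow> g i} \<in> {{}, verts T5}"
      using has_delta_ext_rot5 unfolding verts_basic by blast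
  qed (use assms(2) X in \<open>auto simp: verts_basic\<close>)
qed

lemma homogeneous_set_P7:
  assumes "is_free G Delta122" and "X \<subseteq> verts G" and "digraph_iso (G \<restriction> X) P7"
  shows "homogeneous_set G X"
proof -
  interpret P7: tournament P7 by (rule tournament_P7)
  obtain g where g: "bij_betw g (verts P7) X"
    "\<forall>i\<in>verts P7. \<forall>j\<in>verts P7. i \<rightarrow>\<^bsub>P7\<^esub> j \<longleftrightarrow> g i \<rightarrow> g j"
    using assms(3) unfolding digraph_iso_induce_iff[OF P7.nomulti_digraph assms(2)] by (elim exE conjE)
  have X: "X = g ` verts P7" and inj: "inj_on g (verts P7)"
    using g(1) by (auto simp: bij_betw_def)
  have arcs: "g i \<rightarrow> g j \<longleftrightarrow> rot7 i j" if "i \<in> verts P7" "j \<in> verts P7" for i j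
    using g(2) that by (simp add: arcs_ends_P7)
  show ?thesis
    unfolding X
  proof (rule homogeneous_setI)
    fix w assume w: "w \<in> verts G - g ` verts P7"
    have "\<not> has_delta (insert 0 (verts P7)) (ext rot7 {i \<in> verts P7. w \<rightarrow> g i})"
      using assms(1) inj _ _ arcs w
      by (rule no_delta_ext) (use assms(2) X in \<open>auto simp: verts_basic\<close>)
    moreover have "{i \<in> verts P7. w \<rightarrow> g i} \<in> Pow {1, 2, 3, 4, 5, 6, 7}" unfolding verts_basic by blast
    ultimately show "{i \<in> verts P7. w \<rightarrow> g i} \<in> {{}, verts P7}"
      using has_delta_ext_rot7 unfolding verts_basic by blast
  qed (use assms(2) X in \<open>auto simp: verts_basic\<close>)
qed

lemma P7m_copy:
  assumes "is_free G Delta122" and "X \<subseteq> verts G" and "digraph_iso (G \<restriction> X) P7m"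
  shows "\<exists>g. bij_betw g {1, 2, 3, 4, 5, 6} X \<and>
    (\<forall>i\<in>{1, 2, 3, 4, 5, 6}. \<forall>j\<in>{1, 2, 3, 4, 5, 6}. g i \<rightarrow> g j \<longleftrightarrow> rot7 i j) \<and>
    (\<forall>w\<in>verts G - X.
      {i \<in> {1, 2, 3, 4, 5, 6}. w \<rightarrow> g i} \<in> {{}, {1, 2, 4}, {3, 5, 6}, {1, 2, 3, 4, 5, 6}})"
proof -
  interpret P7m: tournament P7m by (rule tournament_P7m)
  obtain g where g: "bij_betw g (verts P7m) X"
    "\<forall>i\<in>verts P7m. \<forall>j\<in>verts P7m. i \<rightarrow>\<^bsub>P7m\<^esub> j \<longleftrightarrow> g i \<rightarrow> g j"
    using assms(3) unfolding digraph_iso_induce_iff[OF P7m.nomulti_digraph assms(2)] by (elim exE conjE)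
  have X: "X = g ` verts P7m" and inj: "inj_on g (verts P7m)"
    using g(1) by (auto simp: bij_betw_def)
  have arcs: "g i \<rightarrow> g j \<longleftrightarrow> rot7 i j" if "i \<in> verts P7m" "j \<in> verts P7m" for i j
    using g(2) that by (simp add: arcs_ends_P7m)
  have "{i \<in> verts P7m. w \<rightarrow> g i} \<in> {{}, {1, 2, 4}, {3, 5, 6}, verts P7m}" if w: "w \<in> verts G - X" for w
  proof -
    have "w \<in> verts G - g ` verts P7m" using w X by simp
    with assms(1) inj _ _ arcs
    have "\<not> has_delta (insert 0 (verts P7m)) (ext rot7 {i \<in> verts P7m. w \<rightarrow> g i})"
      by (rule no_delta_ext) (use assms(2) X in \<open>auto simp: verts_basic\<close>)
    moreover have "{i \<in> {1, 2, 3, 4, 5, 6}. w \<rightarrow> g i} \<in> Pow {1, 2, 3, 4, 5, 6}" by blast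
    note bspec[OF has_delta_ext_rot7_iff this]
    ultimately show ?thesis unfolding verts_basic by (simp only: not_not)
  qed
  then show ?thesis using g(1) arcs unfolding verts_basic by (intro exI[of _ g] conjI ballI)
qed

text \<open>Each of the four patterns left by \<open>P7m_copy\<close> contains either part of the
  partition entirely or misses it.\<close>

lemma homogeneous_pair_P7m:
  assumes "is_free G Delta122" and "X \<subseteq> verts G" and "digraph_iso (G \<restriction> X) P7m"
  shows "homogeneous_pair G (D1 (G \<restriction> X)) (D2 (G \<restriction> X))"
proof -
  obtain g where bij: "bij_betw g {1, 2, 3, 4, 5, 6} X"
    and arcs: "\<forall>i\<in>{1, 2, 3, 4, 5, 6}. \<forall>j\<in>{1, 2, 3, 4, 5, 6}. g i \<rightarrow> g j \<longleftrightarrow> rot7 i j"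
    and K: "\<forall>w\<in>verts G - X.
      {i \<in> {1, 2, 3, 4, 5, 6}. w \<rightarrow> g i} \<in> {{}, {1, 2, 4}, {3, 5, 6}, {1, 2, 3, 4, 5, 6}}"
    using P7m_copy[OF assms] by (elim exE conjE)
  note arcs = arcs[rule_format] and K = bspec[OF K]
  interpret X: tournament "G \<restriction> X" by (rule tournament_induce[OF tournament assms(2)])
  have X: "X = g ` {1, 2, 3, 4, 5, 6}" and inj: "inj_on g {1, 2, 3, 4, 5, 6}"
    using bij by (auto simp: bij_betw_def)
  have gX: "g i \<in> X" if "i \<in> {1, 2, 3, 4, 5, 6}" for i unfolding X using that by (rule imageI)
  have D: "D1 (G \<restriction> X) = g ` {1, 2, 4}" "D2 (G \<restriction> X) = g ` {3, 5, 6}"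
    using degree_partition[OF X.tournament, of g] bij arcs gX by (auto simp: arcs_ends_induce)
  have sub: "g ` {1, 2, 4} \<subseteq> X" "g ` {3, 5, 6} \<subseteq> X" unfolding X by blast+
  have disj: "g ` {1, 2, 4} \<inter> g ` {3, 5, 6} = {}"
    using inj by simp
  have hom: "homogeneous_set (G \<restriction> (verts G - g ` J)) (g ` I)"
    if IJ: "I = {1, 2, 4} \<and> J = {3, 5, 6} \<or> I = {3, 5, 6} \<and> J = {1, 2, 4}" for I J
  proof -
    have sub: "I \<subseteq> {1, 2, 3, 4, 5, 6}" "I \<noteq> {}" using IJ by auto
    have un: "g ` I \<union> g ` J = X" "g ` I \<inter> g ` J = {}" using IJ inj unfolding X by auto
    interpret R: tournament "G \<restriction> (verts G - g ` J)" by (rule tournament_induce[OF tournament]) blast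
    show ?thesis
    proof (rule R.homogeneous_setI)
      fix w assume "w \<in> verts (G \<restriction> (verts G - g ` J)) - g ` I"
      then have w: "w \<in> verts G - X" "w \<notin> g ` J" using un by auto
      define L where "L = {i \<in> {1, 2, 3, 4, 5, 6}. w \<rightarrow> g i}"
      have "L \<in> {{}, {1, 2, 4}, {3, 5, 6}, {1, 2, 3, 4, 5, 6}}"
        unfolding L_def by (rule K[OF w(1)])
      moreover have "{i \<in> I. w \<rightarrow>\<^bsub>G \<restriction> (verts G - g ` J)\<^esub> g i} = I \<inter> L"
        using w un sub gX assms(2) by (auto simp: arcs_ends_induce L_def)
      ultimately show "{i \<in> I. w \<rightarrow>\<^bsub>G \<restriction> (verts G - g ` J)\<^esub> g i} \<in> {{}, I}"
        using IJ by (elim insertE emptyE disjE conjE) simp_all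
    qed (use un assms(2) sub in auto)
  qed
  show ?thesis
    unfolding homogeneous_pair_def D
    using disj sub assms(2) hom[of "{1, 2, 4}" "{3, 5, 6}"] hom[of "{3, 5, 6}" "{1, 2, 4}"]
    by (intro conjI) (blast | simp)+
qed

end

section \<open>Substitution\<close>

lemma verts_substitute: "verts (substitute G v S) = Inl ` (verts G - {v}) \<union> Inr ` verts S"
  by (simp add: substitute_def Let_def)

lemma arcs_ends_substitute:
  "Inl a \<rightarrow>\<^bsub>substitute G v S\<^esub> Inl b \<longleftrightarrow> a \<in> verts G - {v} \<and> b \<in> verts G - {v} \<and> a \<rightarrow>\<^bsub>G\<^esub> b"
  "Inr s \<rightarrow>\<^bsub>substitute G v S\<^esub> Inr t \<longleftrightarrow> s \<rightarrow>\<^bsub>S\<^esub> t"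
  "Inl a \<rightarrow>\<^bsub>substitute G v S\<^esub> Inr t \<longleftrightarrow> a \<in> verts G - {v} \<and> t \<in> verts S \<and> a \<rightarrow>\<^bsub>G\<^esub> v"
  "Inr s \<rightarrow>\<^bsub>substitute G v S\<^esub> Inl b \<longleftrightarrow> b \<in> verts G - {v} \<and> s \<in> verts S \<and> v \<rightarrow>\<^bsub>G\<^esub> b"
  by (simp_all add: substitute_def Let_def)

lemma tournament_substitute:
  assumes "tournament G" and "v \<in> verts G" and "tournament S"
  shows "tournament (substitute G v S)"
proof -
  interpret G: tournament G by fact
  interpret S: tournament S by fact
  have inS: "s \<in> verts S" "t \<in> verts S" if "s \<rightarrow>\<^bsub>S\<^esub> t" for s t
    using S.adj_in_verts[OF that] .
  show ?thesis
    unfolding substitute_def Let_def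
  proof (rule tournament_with_proj, goal_cases)
    case (3 p q)
    then show ?case
    proof (cases p; cases q)
      fix a b assume "p = Inl a" "q = Inl b"
      then show ?case using G.exactly_one_arc[of a b] 3 by auto
    next
      fix a t assume "p = Inl a" "q = Inr t"
      then show ?case using G.exactly_one_arc[of a v] 3 assms(2) by auto
    next
      fix s b assume "p = Inr s" "q = Inl b"
      then show ?case using G.exactly_one_arc[of v b] 3 assms(2) by auto
    next
      fix s t assume "p = Inr s" "q = Inr t"
      then show ?case using S.exactly_one_arc[of s t] 3 by auto
    qed
  qed (use inS G.irrefl S.irrefl in auto)
qed

text \<open>Contracting the inserted copy to \<open>v\<close> sends a \<Delta>(1,2,2) to one in
  \<open>G\<close>, unless the copy contains all of it or one of its two pairs. Freeness of
  \<open>S\<close> excludes the former and niceness of \<open>v\<close> the latter.\<close>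

lemma is_free_substitute:
  fixes G :: "('a, 'b) pre_digraph" and S :: "('c, 'd) pre_digraph"
  assumes "tournament G" and "is_free G Delta122" and "nice_vertex G v"
    and "tournament S" and "is_free S Delta122"
  shows "is_free (substitute G v S) Delta122"
proof -
  interpret G: tournament G by fact
  interpret S: tournament S by fact
  have v: "v \<in> verts G" using assms(3) by (simp add: nice_vertex_def)
  interpret H: tournament "substitute G v S" by (rule tournament_substitute) fact+
  have no_G: "\<not> delta (\<lambda>a b. a \<rightarrow>\<^bsub>G\<^esub> b) x y1 y2 z1 z2" for x y1 y2 z1 z2
    using assms(2) G.is_free_Delta122_iff by blast
  have no_S: "\<not> delta (\<lambda>a b. a \<rightarrow>\<^bsub>S\<^esub> b) x y1 y2 z1 z2" for x y1 y2 z1 z2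
    using assms(5) S.is_free_Delta122_iff by blast
  \<comment> \<open>Niceness for an arc leaving \<open>v\<close>; \<open>nice'\<close> is the same
    for an arc entering \<open>v\<close>.\<close>
  have nice: "a = b" if "v \<rightarrow>\<^bsub>G\<^esub> x" "x \<rightarrow>\<^bsub>G\<^esub> a" "a \<rightarrow>\<^bsub>G\<^esub> v" "x \<rightarrow>\<^bsub>G\<^esub> b" "b \<rightarrow>\<^bsub>G\<^esub> v"
    for x a b
  proof (rule ccontr)
    assume "a \<noteq> b"
    moreover have "x \<noteq> a" "x \<noteq> b" using that G.irrefl by auto
    ultimately show False
      using assms(3) that unfolding nice_vertex_def cyclic_triangle_def by auto
  qed
  have nice': "a = b" if "x \<rightarrow>\<^bsub>G\<^esub> v" "v \<rightarrow>\<^bsub>G\<^esub> a" "a \<rightarrow>\<^bsub>G\<^esub> x" "v \<rightarrow>\<^bsub>G\<^esub> b" "b \<rightarrow>\<^bsub>G\<^esub> x"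
    for x a b
  proof (rule ccontr)
    assume "a \<noteq> b"
    moreover have "x \<noteq> a" "x \<noteq> b" using that G.irrefl by auto
    ultimately show False
      using assms(3) that unfolding nice_vertex_def cyclic_triangle_def by auto
  qed
  have "\<not> delta (\<lambda>a b. a \<rightarrow>\<^bsub>substitute G v S\<^esub> b) x y1 y2 z1 z2" for x y1 y2 z1 z2
  proof
    assume d: "delta (\<lambda>a b. a \<rightarrow>\<^bsub>substitute G v S\<^esub> b) x y1 y2 z1 z2"
    define I where "I p \<longleftrightarrow> p \<in> range Inr" for p :: "'a + 'c"
    \<comment> \<open>The contraction; only arcs inside the inserted part are lost, as they become
      loops at \<open>v\<close>.\<close>
    define f :: "'a + 'c \<Rightarrow> 'a" where "f = case_sum (\<lambda>w. w) (\<lambda>_. v)"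
    have arc: "f p \<rightarrow>\<^bsub>G\<^esub> f q" if "p \<rightarrow>\<^bsub>substitute G v S\<^esub> q" "\<not> (I p \<and> I q)" for p q
      using that by (cases p; cases q) (auto simp: I_def f_def arcs_ends_substitute)
    have inj: "f p \<noteq> f q" if "p \<noteq> q" "\<not> (I p \<and> I q)" "p \<in> verts (substitute G v S)"
      "q \<in> verts (substitute G v S)" for p q
      using that by (cases p; cases q) (auto simp: I_def f_def verts_substitute)
    have f_I: "f p = v" if "I p" for p
      using that by (auto simp: I_def f_def)
    \<comment> \<open>The inserted part is homogeneous, so a vertex with arcs both to and from it
      lies inside.\<close>
    have hom: "I r" if "r \<rightarrow>\<^bsub>substitute G v S\<^esub> p" "q \<rightarrow>\<^bsub>substitute G v S\<^esub> r" "I p" "I q" for p q r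
      using arc[OF that(1)] arc[OF that(2)] f_I that(3,4) G.asym by metis
    have arcs: "x \<rightarrow>\<^bsub>substitute G v S\<^esub> y1" "x \<rightarrow>\<^bsub>substitute G v S\<^esub> y2"
      "y1 \<rightarrow>\<^bsub>substitute G v S\<^esub> z1" "y1 \<rightarrow>\<^bsub>substitute G v S\<^esub> z2"
      "y2 \<rightarrow>\<^bsub>substitute G v S\<^esub> z1" "y2 \<rightarrow>\<^bsub>substitute G v S\<^esub> z2"
      "z1 \<rightarrow>\<^bsub>substitute G v S\<^esub> x" "z2 \<rightarrow>\<^bsub>substitute G v S\<^esub> x" "y1 \<noteq> y2" "z1 \<noteq> z2"
      using d by (auto simp: delta_def)
    note verts = arcs(1-8)[THEN H.adj_in_verts(1)] arcs(1-8)[THEN H.adj_in_verts(2)]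
    \<comment> \<open>If both ends of an arc demanded by \<open>delta\<close> are inserted,
      \<open>hom\<close> spreads this to all five vertices. Otherwise at most \<open>y1\<close>,
      \<open>y2\<close>, or \<open>z1\<close>, \<open>z2\<close>, can be inserted together, as
      \<open>delta\<close> demands no arc within these pairs.\<close>
    have "I x \<and> I y1 \<and> I y2 \<and> I z1 \<and> I z2 \<or>
      \<not> ((I x \<or> I y1 \<or> I y2) \<and> (I z1 \<or> I z2)) \<and> \<not> (I x \<and> (I y1 \<or> I y2))"
      using hom[OF arcs(1) arcs(7)] hom[OF arcs(1) arcs(8)] hom[OF arcs(2) arcs(7)] hom[OF arcs(2) arcs(8)]
        hom[OF arcs(3) arcs(1)] hom[OF arcs(4) arcs(1)] hom[OF arcs(5) arcs(2)] hom[OF arcs(6) arcs(2)]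
        hom[OF arcs(7) arcs(3)] hom[OF arcs(7) arcs(5)] hom[OF arcs(8) arcs(4)] hom[OF arcs(8) arcs(6)]
      by blast
    then show False
    proof
      assume "I x \<and> I y1 \<and> I y2 \<and> I z1 \<and> I z2"
      then obtain x' y1' y2' z1' z2' where "x = Inr x'" "y1 = Inr y1'" "y2 = Inr y2'" "z1 = Inr z1'" "z2 = Inr z2'"
        unfolding I_def by blast
      then show False
        using no_S[of x' y1' y2' z1' z2'] d by (simp add: delta_def arcs_ends_substitute)
    next
      assume I: "\<not> ((I x \<or> I y1 \<or> I y2) \<and> (I z1 \<or> I z2)) \<and> \<not> (I x \<and> (I y1 \<or> I y2))"
      have f_arcs: "f x \<rightarrow>\<^bsub>G\<^esub> f y1" "f x \<rightarrow>\<^bsub>G\<^esub> f y2" "f y1 \<rightarrow>\<^bsub>G\<^esub> f z1" "f y1 \<rightarrow>\<^bsub>G\<^esub> f z2"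
        "f y2 \<rightarrow>\<^bsub>G\<^esub> f z1" "f y2 \<rightarrow>\<^bsub>G\<^esub> f z2" "f z1 \<rightarrow>\<^bsub>G\<^esub> f x" "f z2 \<rightarrow>\<^bsub>G\<^esub> f x"
        using arcs(1-8)[THEN arc] I by blast+
      \<comment> \<open>With \<open>y1\<close> and \<open>y2\<close> contracted to \<open>v\<close>,
        the arc from \<open>f x\<close> to \<open>v\<close> would lie in cyclic triangles with
        \<open>f z1\<close> and with \<open>f z2\<close>.\<close>
      have "\<not> (I y1 \<and> I y2)"
        using nice'[of "f x" "f z1" "f z2"] f_I f_arcs inj[OF arcs(10)] verts I by metis
      moreover have "\<not> (I z1 \<and> I z2)"
        using nice[of "f x" "f y1" "f y2"] f_I f_arcs inj[OF arcs(9)] verts I by metis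
      ultimately have "delta (\<lambda>a b. a \<rightarrow>\<^bsub>G\<^esub> b) (f x) (f y1) (f y2) (f z1) (f z2)"
        using f_arcs inj[OF arcs(9)] inj[OF arcs(10)] verts unfolding delta_def by blast
      then show False using no_G by blast
    qed
  qed
  then show ?thesis unfolding H.is_free_Delta122_iff by blast
qed


section \<open>Bridges\<close>

text \<open>Edges are unordered pairs of vertices. Distinctness of the list recovers the positions,
  and of the two ways to match them only the one with the tail on the later side respects the
  order.\<close>

lemma edges_between_backedges_iff:
  assumes "distinct \<sigma>"
  shows "e \<in> edges_between (backedges G \<sigma>) {\<sigma> ! s | s. s < k} {\<sigma> ! t | t. k < t \<and> t < length \<sigma>}
    \<longleftrightarrow> (\<exists>s t. s < k \<and> k < t \<and> t < length \<sigma> \<and> e = {\<sigma> ! s, \<sigma> ! t} \<and> \<sigma> ! t \<rightarrow>\<^bsub>G\<^esub> \<sigma> ! s)"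
    (is "?L \<longleftrightarrow> ?R")
proof
  assume ?L
  then obtain s t i j where st: "s < k" "k < t" "t < length \<sigma>" "e = {\<sigma> ! s, \<sigma> ! t}"
    and ij: "i < length \<sigma>" "j < i" "e = {\<sigma> ! i, \<sigma> ! j}" "\<sigma> ! i \<rightarrow>\<^bsub>G\<^esub> \<sigma> ! j"
    unfolding edges_between_def backedges_def by blast
  have "\<sigma> ! s = \<sigma> ! i \<and> \<sigma> ! t = \<sigma> ! j \<or> \<sigma> ! s = \<sigma> ! j \<and> \<sigma> ! t = \<sigma> ! i"
    using st(4) ij(3) by (metis doubleton_eq_iff)
  then have "s = i \<and> t = j \<or> s = j \<and> t = i"
    using assms st ij by (simp add: nth_eq_iff_index_eq)
  then have "s = j \<and> t = i" using st ij by linarith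
  then show ?R using st ij by blast
next
  assume ?R
  then obtain s t where st: "s < k" "k < t" "t < length \<sigma>" "e = {\<sigma> ! s, \<sigma> ! t}" "\<sigma> ! t \<rightarrow>\<^bsub>G\<^esub> \<sigma> ! s"
    by blast
  then have "e \<in> backedges G \<sigma>"
    unfolding backedges_def using insert_commute[of "\<sigma> ! s" "\<sigma> ! t" "{}"]
    by (intro CollectI exI[of _ t] exI[of _ s]) simp
  then show ?L unfolding edges_between_def using st by blast
qed

text \<open>The ends of a crossing edge lie on different sides of \<open>k\<close>, so two such
  edges can only meet in their earlier or in their later ends.\<close>

lemma matching_across_iff:
  assumes "distinct \<sigma>"
  shows "matching_across G \<sigma> k \<longleftrightarrow> (\<forall>s t s' t'. s < k \<and> k < t \<and> t < length \<sigma> \<and> \<sigma> ! t \<rightarrow>\<^bsub>G\<^esub> \<sigma> ! s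
    \<and> s' < k \<and> k < t' \<and> t' < length \<sigma> \<and> \<sigma> ! t' \<rightarrow>\<^bsub>G\<^esub> \<sigma> ! s' \<and> (s = s' \<or> t = t') \<longrightarrow> s = s' \<and> t = t')"
    (is "?L \<longleftrightarrow> ?R")
proof
  assume L: ?L
  show ?R
  proof (intro allI impI)
    fix s t s' t'
    assume a: "s < k \<and> k < t \<and> t < length \<sigma> \<and> \<sigma> ! t \<rightarrow>\<^bsub>G\<^esub> \<sigma> ! s
    \<and> s' < k \<and> k < t' \<and> t' < length \<sigma> \<and> \<sigma> ! t' \<rightarrow>\<^bsub>G\<^esub> \<sigma> ! s' \<and> (s = s' \<or> t = t')"
    let ?M = "edges_between (backedges G \<sigma>) {\<sigma> ! s | s. s < k} {\<sigma> ! t | t. k < t \<and> t < length \<sigma>}"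
    have "{\<sigma> ! s, \<sigma> ! t} \<in> ?M" "{\<sigma> ! s', \<sigma> ! t'} \<in> ?M"
      unfolding edges_between_backedges_iff[OF assms] using a by blast+
    moreover have "{\<sigma> ! s, \<sigma> ! t} \<inter> {\<sigma> ! s', \<sigma> ! t'} \<noteq> {}" using a by auto
    ultimately have "{\<sigma> ! s, \<sigma> ! t} = {\<sigma> ! s', \<sigma> ! t'}"
      using L[unfolded matching_across_def is_matching_def] bspec by meson
    then have "\<sigma> ! s = \<sigma> ! s' \<and> \<sigma> ! t = \<sigma> ! t' \<or> \<sigma> ! s = \<sigma> ! t' \<and> \<sigma> ! t = \<sigma> ! s'"
      by (metis doubleton_eq_iff)
    then show "s = s' \<and> t = t'"
      using assms a by (simp add: nth_eq_iff_index_eq)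
  qed
next
  assume R: ?R
  show ?L
    unfolding matching_across_def is_matching_def
  proof (intro ballI impI)
    fix e f
    assume "e \<in> edges_between (backedges G \<sigma>) {\<sigma> ! s | s. s < k} {\<sigma> ! t | t. k < t \<and> t < length \<sigma>}"
    then obtain s t where st: "s < k" "k < t" "t < length \<sigma>" "e = {\<sigma> ! s, \<sigma> ! t}" "\<sigma> ! t \<rightarrow>\<^bsub>G\<^esub> \<sigma> ! s"
      unfolding edges_between_backedges_iff[OF assms] by blast
    assume "f \<in> edges_between (backedges G \<sigma>) {\<sigma> ! s | s. s < k} {\<sigma> ! t | t. k < t \<and> t < length \<sigma>}"
    then obtain s' t' where st': "s' < k" "k < t'" "t' < length \<sigma>" "f = {\<sigma> ! s', \<sigma> ! t'}" "\<sigma> ! t' \<rightarrow>\<^bsub>G\<^esub> \<sigma> ! s'"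
      unfolding edges_between_backedges_iff[OF assms] by blast
    assume "e \<noteq> f"
    then have "\<not> (s = s' \<or> t = t')" using R st st' by blast
    then have "\<sigma> ! s \<noteq> \<sigma> ! s'" "\<sigma> ! t \<noteq> \<sigma> ! t'" "\<sigma> ! s \<noteq> \<sigma> ! t'" "\<sigma> ! t \<noteq> \<sigma> ! s'"
      using assms st st' by (simp_all add: nth_eq_iff_index_eq)
    then show "e \<inter> f = {}" unfolding st(4) st'(4) by blast
  qed
qed

section \<open>Bridges described without an ordering\<close>

text \<open>The matching condition at the position of \<open>v\<close>, freed from the ordering:
  backedges crossing that position become arcs from out-neighbours to in-neighbours of
  \<open>v\<close>. The set \<open>U\<close> of ignored vertices will consist of the two ends of the
  bridge.\<close>

definition locally_matched :: "('a, 'b) pre_digraph \<Rightarrow> 'a set \<Rightarrow> 'a \<Rightarrow> bool" where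
  "locally_matched G U v \<longleftrightarrow> (\<forall>a b a' b'. {a, b, a', b'} \<inter> U = {} \<and>
     a \<rightarrow>\<^bsub>G\<^esub> v \<and> v \<rightarrow>\<^bsub>G\<^esub> b \<and> b \<rightarrow>\<^bsub>G\<^esub> a \<and> a' \<rightarrow>\<^bsub>G\<^esub> v \<and> v \<rightarrow>\<^bsub>G\<^esub> b' \<and> b' \<rightarrow>\<^bsub>G\<^esub> a' \<and>
     (a = a' \<or> b = b') \<longrightarrow> a = a' \<and> b = b')"

lemma locally_matchedD:
  assumes "locally_matched G U v" and "{a, b, a', b'} \<inter> U = {}"
    and "a \<rightarrow>\<^bsub>G\<^esub> v" "v \<rightarrow>\<^bsub>G\<^esub> b" "b \<rightarrow>\<^bsub>G\<^esub> a" "a' \<rightarrow>\<^bsub>G\<^esub> v" "v \<rightarrow>\<^bsub>G\<^esub> b'" "b' \<rightarrow>\<^bsub>G\<^esub> a'"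
    and "a = a' \<or> b = b'"
  shows "a = a' \<and> b = b'"
  by (rule assms(1)[unfolded locally_matched_def, rule_format]) (intro conjI; fact assms)

context tournament
begin

text \<open>The last two assumptions say that position \<open>k\<close> separates the in-neighbours
  of \<open>v\<close> from its out-neighbours, so arcs back from the latter to the former cross
  \<open>k\<close>.\<close>

lemma locally_matched_if_matching_across:
  assumes "vertex_ordering G \<sigma>" and "matching_across G \<sigma> k"
    and arc_before: "\<And>p. p < length \<sigma> \<Longrightarrow> \<sigma> ! p \<notin> U \<Longrightarrow> \<sigma> ! p \<rightarrow> v \<Longrightarrow> p < k"
    and arc_after: "\<And>p. p < length \<sigma> \<Longrightarrow> \<sigma> ! p \<notin> U \<Longrightarrow> v \<rightarrow> \<sigma> ! p \<Longrightarrow> k < p"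
  shows "locally_matched G U v"
  unfolding locally_matched_def
proof (intro allI impI)
  fix a b a' b'
  assume *: "{a, b, a', b'} \<inter> U = {} \<and> a \<rightarrow> v \<and> v \<rightarrow> b \<and> b \<rightarrow> a \<and> a' \<rightarrow> v \<and> v \<rightarrow> b' \<and> b' \<rightarrow> a' \<and>
     (a = a' \<or> b = b')"
  have \<sigma>: "distinct \<sigma>" "set \<sigma> = verts G" using assms(1) by (auto simp: vertex_ordering_def)
  have "a \<in> set \<sigma>" "b \<in> set \<sigma>" "a' \<in> set \<sigma>" "b' \<in> set \<sigma>"
    using * adj_in_verts[of b a] adj_in_verts[of b' a'] \<sigma>(2) by simp_all
  then obtain s t s' t' where idx: "s < length \<sigma>" "t < length \<sigma>" "s' < length \<sigma>" "t' < length \<sigma>"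
    and eq: "a = \<sigma> ! s" "b = \<sigma> ! t" "a' = \<sigma> ! s'" "b' = \<sigma> ! t'"
    by (metis in_set_conv_nth)
  have "s < k" "s' < k" "k < t" "k < t'"
    using arc_before[OF idx(1)] arc_before[OF idx(3)] arc_after[OF idx(2)] arc_after[OF idx(4)] * eq by auto
  moreover have "s = s' \<or> t = t'"
    using * idx eq \<sigma>(1) by (simp add: nth_eq_iff_index_eq)
  ultimately have "s = s' \<and> t = t'"
    using * idx eq by (intro assms(2)[unfolded matching_across_iff[OF \<sigma>(1)], rule_format]) simp
  then show "a = a' \<and> b = b'" using eq by simp
qed

text \<open>A backedge graph in which \<open>uv\<close> is isolated puts the in-neighbours of \<open>v\<close> other than \<open>u\<close> before
  \<open>v\<close> and its out-neighbours after \<open>v\<close>, and likewise for \<open>u\<close>, so that being a bridge does not depend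
  on the ordering chosen within the three blocks.\<close>

lemma bridgeD:
  assumes "bridge G u v"
  shows "u \<rightarrow> v" and "\<not> (u \<rightarrow> w \<and> w \<rightarrow> v)"
    and "locally_matched G {u, v} u" and "locally_matched G {u, v} v"
proof -
  from assms obtain \<sigma> i j where arc: "u \<rightarrow> v" and ord: "vertex_ordering G \<sigma>"
    and ij: "i < length \<sigma>" "j < i" "u = \<sigma> ! i" "v = \<sigma> ! j"
    and iso: "isolated_edge (backedges G \<sigma>) {u, v}"
    and match: "matching_across G \<sigma> i" "matching_across G \<sigma> j"
    unfolding bridge_def by blast
  have \<sigma>: "distinct \<sigma>" "set \<sigma> = verts G" using ord by (auto simp: vertex_ordering_def)
  \<comment> \<open>Any other backedge at position \<open>i\<close> or \<open>j\<close> would meet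
    the isolated edge.\<close>
  have no_back: False if "q < p" "p < length \<sigma>" "\<sigma> ! p \<rightarrow> \<sigma> ! q" "p \<in> {i, j} \<or> q \<in> {i, j}" "\<not> (p = i \<and> q = j)" for p q
  proof -
    have "{\<sigma> ! p, \<sigma> ! q} \<in> backedges G \<sigma>" using that unfolding backedges_def by blast
    moreover have "{\<sigma> ! p, \<sigma> ! q} \<inter> {u, v} \<noteq> {}" using that(4) ij by auto
    moreover have "{\<sigma> ! p, \<sigma> ! q} \<noteq> {u, v}"
    proof
      assume "{\<sigma> ! p, \<sigma> ! q} = {u, v}"
      then have "p = i \<and> q = j \<or> p = j \<and> q = i"
        using ij that(1,2) \<sigma>(1) by (auto simp: doubleton_eq_iff nth_eq_iff_index_eq)
      then show False using that(1,5) ij(2) by auto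
    qed
    moreover have "\<forall>f\<in>backedges G \<sigma>. f \<noteq> {u, v} \<longrightarrow> f \<inter> {u, v} = {}"
      using iso unfolding isolated_edge_def by (rule conjunct2)
    ultimately show False by simp
  qed
  have in_idx: "p \<noteq> i" "p \<noteq> j" if "p < length \<sigma>" "\<sigma> ! p \<notin> {u, v}" for p using that ij by auto
  have u_before: "p < i" if "p < length \<sigma>" "\<sigma> ! p \<notin> {u, v}" "\<sigma> ! p \<rightarrow> u" for p
    using no_back[of i p] in_idx[OF that(1,2)] that ij by (cases p i rule: linorder_cases) auto
  have u_after: "i < p" if "p < length \<sigma>" "\<sigma> ! p \<notin> {u, v}" "u \<rightarrow> \<sigma> ! p" for p
    using no_back[of p i] in_idx[OF that(1,2)] that ij by (cases p i rule: linorder_cases) auto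
  have v_before: "p < j" if "p < length \<sigma>" "\<sigma> ! p \<notin> {u, v}" "\<sigma> ! p \<rightarrow> v" for p
    using no_back[of j p] in_idx[OF that(1,2)] that ij by (cases p j rule: linorder_cases) auto
  have v_after: "j < p" if "p < length \<sigma>" "\<sigma> ! p \<notin> {u, v}" "v \<rightarrow> \<sigma> ! p" for p
    using no_back[of p j] in_idx[OF that(1,2)] that ij by (cases p j rule: linorder_cases) auto
  show "u \<rightarrow> v" by fact
  show "\<not> (u \<rightarrow> w \<and> w \<rightarrow> v)"
  proof
    assume w: "u \<rightarrow> w \<and> w \<rightarrow> v"
    then have "w \<in> set \<sigma>" "w \<notin> {u, v}" using \<sigma>(2) adj_in_verts irrefl by auto
    then obtain p where "p < length \<sigma>" "w = \<sigma> ! p" by (metis in_set_conv_nth)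
    \<comment> \<open>Such a \<open>w\<close> would come after \<open>u\<close> and before
      \<open>v\<close>, although \<open>v\<close> precedes \<open>u\<close>.\<close>
    then show False using u_after[of p] v_before[of p] w \<open>w \<notin> {u, v}\<close> ij(2) by simp
  qed
  show "locally_matched G {u, v} u"
    by (rule locally_matched_if_matching_across[OF ord match(1)]) (fact u_before u_after)+
  show "locally_matched G {u, v} v"
    by (rule locally_matched_if_matching_across[OF ord match(2)]) (fact v_before v_after)+
qed

text \<open>The witness is the ordering \<open>A\<close>, \<open>v\<close>, \<open>C\<close>,
  \<open>u\<close>, \<open>B\<close>, with each block listed arbitrarily. The assumption
  \<open>none\<close> excludes the fourth type of vertex, so the three blocks exhaust the
  rest.\<close>

lemma bridgeI:
  assumes arc: "u \<rightarrow> v" and none: "\<And>w. \<not> (u \<rightarrow> w \<and> w \<rightarrow> v)"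
    and u: "locally_matched G {u, v} u" and v: "locally_matched G {u, v} v"
  shows "bridge G u v"
proof -
  have uv: "u \<in> verts G" "v \<in> verts G" "u \<noteq> v" using arc adj_in_verts irrefl by auto
  define A where "A = {w \<in> verts G - {u, v}. w \<rightarrow> v \<and> w \<rightarrow> u}"
  define C where "C = {w \<in> verts G - {u, v}. v \<rightarrow> w \<and> w \<rightarrow> u}"
  define B where "B = {w \<in> verts G - {u, v}. v \<rightarrow> w \<and> u \<rightarrow> w}"
  have ABC: "verts G = A \<union> {v} \<union> C \<union> {u} \<union> B" "A \<inter> C = {}" "A \<inter> B = {}" "C \<inter> B = {}"
    "u \<notin> A \<union> B \<union> C" "v \<notin> A \<union> B \<union> C"
  proof -
    have "w \<in> A \<union> C \<union> B" if "w \<in> verts G - {u, v}" for w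
      using none[of w] total[of w u] total[of w v] uv that unfolding A_def B_def C_def by blast
    then show "verts G = A \<union> {v} \<union> C \<union> {u} \<union> B"
      using uv unfolding A_def B_def C_def by blast
  qed (auto simp: A_def B_def C_def dest: asym)
  have "finite A" "finite B" "finite C" unfolding A_def B_def C_def by simp_all
  then obtain As Bs Cs where lists: "set As = A" "distinct As" "set Bs = B" "distinct Bs" "set Cs = C" "distinct Cs"
    using finite_distinct_list by metis
  define \<sigma> where "\<sigma> = As @ [v] @ Cs @ [u] @ Bs"
  define j where "j = length As"
  \<comment> \<open>The position of \<open>u\<close>: \<open>v\<close> stands at \<open>j\<close>
    and is followed by the block \<open>Cs\<close>.\<close>
  define i where "i = Suc (j + length Cs)"
  have ord: "vertex_ordering G \<sigma>"
    using lists ABC uv(3) unfolding vertex_ordering_def \<sigma>_def by auto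
  then have dist: "distinct \<sigma>" by (simp add: vertex_ordering_def)
  have len: "length \<sigma> = Suc (i + length Bs)" by (simp add: \<sigma>_def i_def j_def)
  have ij: "j < i" "i < length \<sigma>" by (simp_all add: len i_def)
  have nth: "\<sigma> ! j = v" "\<sigma> ! i = u" by (simp_all add: \<sigma>_def i_def j_def nth_append)
  have in_A: "\<sigma> ! p \<in> A" if "p < j" for p
    using that lists(1) nth_mem[of p As] by (simp add: \<sigma>_def j_def nth_append)
  have in_C: "\<sigma> ! p \<in> C" if "j < p" "p < i" for p
    using that lists(5) nth_mem[of "p - Suc j" Cs] by (auto simp: \<sigma>_def i_def j_def nth_append nth_Cons')
  have in_B: "\<sigma> ! p \<in> B" if "i < p" "p < length \<sigma>" for p
    using that lists(3) nth_mem[of "p - Suc i" Bs] by (auto simp: \<sigma>_def i_def j_def nth_append nth_Cons')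
  have to_v: "\<sigma> ! p \<rightarrow> v" if "p < j" for p using in_A[OF that] by (simp add: A_def)
  have from_v: "v \<rightarrow> \<sigma> ! p" if "j < p" "p < length \<sigma>" "p \<noteq> i" for p
    using in_C[of p] in_B[of p] that by (cases p i rule: linorder_cases) (auto simp: C_def B_def)
  have to_u: "\<sigma> ! p \<rightarrow> u" if "p < i" "p \<noteq> j" for p
    using in_A[of p] in_C[of p] that by (cases p j rule: linorder_cases) (auto simp: A_def C_def)
  have from_u: "u \<rightarrow> \<sigma> ! p" if "i < p" "p < length \<sigma>" for p
    using in_B[OF that] by (simp add: B_def)
  have outside: "\<sigma> ! p \<notin> {u, v}" if "p < length \<sigma>" "p \<noteq> i" "p \<noteq> j" for p
    using that dist ij nth by (metis empty_iff insert_iff nth_eq_iff_index_eq order.strict_trans)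
  have "isolated_edge (backedges G \<sigma>) {u, v}"
    unfolding isolated_edge_def
  proof (intro conjI ballI impI)
    show "{u, v} \<in> backedges G \<sigma>"
      unfolding backedges_def using ij nth arc by blast
    fix f assume "f \<in> backedges G \<sigma>" and f: "f \<noteq> {u, v}"
    then obtain p q where pq: "p < length \<sigma>" "q < p" "f = {\<sigma> ! p, \<sigma> ! q}" "\<sigma> ! p \<rightarrow> \<sigma> ! q"
      unfolding backedges_def by blast
    have "\<not> (p = i \<and> q = j)" using pq(3) f nth by auto
    moreover have "p \<noteq> j" using pq asym to_v[of q] nth by auto
    moreover have "q \<noteq> i" using pq asym from_u[of p] nth by auto
    moreover have "p = i \<Longrightarrow> q = j" using pq asym to_u[of q] nth by auto
    moreover have "q = j \<Longrightarrow> p = i" using pq asym from_v[of p] nth by auto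
    ultimately have "p \<noteq> i" "p \<noteq> j" "q \<noteq> i" "q \<noteq> j" by auto
    then show "f \<inter> {u, v} = {}" using outside[of p] outside[of q] pq by auto
  qed
  moreover have "matching_across G \<sigma> j"
    unfolding matching_across_iff[OF dist]
  proof (intro allI impI)
    fix s t s' t'
    assume *: "s < j \<and> j < t \<and> t < length \<sigma> \<and> \<sigma> ! t \<rightarrow> \<sigma> ! s
      \<and> s' < j \<and> j < t' \<and> t' < length \<sigma> \<and> \<sigma> ! t' \<rightarrow> \<sigma> ! s' \<and> (s = s' \<or> t = t')"
    \<comment> \<open>Vertices before \<open>v\<close> dominate \<open>u\<close>, so no edge
      crossing \<open>j\<close> has its later end at \<open>u\<close>. Hence \<open>u\<close> and
      \<open>v\<close> are avoided, as \<open>locally_matched\<close> requires.\<close>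
    then have idx: "t \<noteq> i" "t' \<noteq> i" using to_u asym nth ij by (metis order.strict_trans order.strict_implies_not_eq)+
    have "\<sigma> ! s = \<sigma> ! s' \<and> \<sigma> ! t = \<sigma> ! t'"
    proof (rule locally_matchedD[OF v])
      show "{\<sigma> ! s, \<sigma> ! t, \<sigma> ! s', \<sigma> ! t'} \<inter> {u, v} = {}"
        using outside[of s] outside[of t] outside[of s'] outside[of t'] * ij idx by simp
    qed (use * to_v from_v ij idx in \<open>auto\<close>)
    then show "s = s' \<and> t = t'" using * dist ij by (simp add: nth_eq_iff_index_eq)
  qed
  moreover have "matching_across G \<sigma> i"
    unfolding matching_across_iff[OF dist]
  proof (intro allI impI)
    fix s t s' t'
    assume *: "s < i \<and> i < t \<and> t < length \<sigma> \<and> \<sigma> ! t \<rightarrow> \<sigma> ! s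
      \<and> s' < i \<and> i < t' \<and> t' < length \<sigma> \<and> \<sigma> ! t' \<rightarrow> \<sigma> ! s' \<and> (s = s' \<or> t = t')"
    then have idx: "s \<noteq> j" "s' \<noteq> j" using from_v asym nth ij by (metis order.strict_trans order.strict_implies_not_eq)+
    have "\<sigma> ! s = \<sigma> ! s' \<and> \<sigma> ! t = \<sigma> ! t'"
    proof (rule locally_matchedD[OF u])
      show "{\<sigma> ! s, \<sigma> ! t, \<sigma> ! s', \<sigma> ! t'} \<inter> {u, v} = {}"
        using outside[of s] outside[of t] outside[of s'] outside[of t'] * ij idx by simp
    qed (use * to_u from_u ij idx in \<open>auto\<close>)
    then show "s = s' \<and> t = t'" using * dist ij by (simp add: nth_eq_iff_index_eq)
  qed
  ultimately show ?thesis
    unfolding bridge_def using arc ord ij nth by metis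
qed

end


section \<open>Joins\<close>

lemma verts_P7m_join: "verts (P7m_join G u v) = Inl ` (verts G - {u, v}) \<union> Inr ` {1, 2, 3, 4, 5, 6}"
  by (simp add: P7m_join_def Let_def verts_basic)

lemma arcs_ends_P7m_join:
  "Inl a \<rightarrow>\<^bsub>P7m_join G u v\<^esub> Inl b \<longleftrightarrow> a \<in> verts G - {u, v} \<and> b \<in> verts G - {u, v} \<and> a \<rightarrow>\<^bsub>G\<^esub> b"
  "Inr s \<rightarrow>\<^bsub>P7m_join G u v\<^esub> Inr t \<longleftrightarrow> s \<rightarrow>\<^bsub>P7m\<^esub> t"
  "Inl a \<rightarrow>\<^bsub>P7m_join G u v\<^esub> Inr t \<longleftrightarrow> a \<in> verts G - {u, v} \<and>
     (t \<in> {3, 5, 6} \<and> a \<rightarrow>\<^bsub>G\<^esub> u \<or> t \<in> {1, 2, 4} \<and> a \<rightarrow>\<^bsub>G\<^esub> v)"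
  "Inr s \<rightarrow>\<^bsub>P7m_join G u v\<^esub> Inl b \<longleftrightarrow> b \<in> verts G - {u, v} \<and>
     (s \<in> {3, 5, 6} \<and> u \<rightarrow>\<^bsub>G\<^esub> b \<or> s \<in> {1, 2, 4} \<and> v \<rightarrow>\<^bsub>G\<^esub> b)"
  by (simp_all add: P7m_join_def Let_def degree_partition_P7m) blast+

lemma tournament_P7m_join:
  assumes "tournament G" and "u \<in> verts G" and "v \<in> verts G"
  shows "tournament (P7m_join G u v)"
proof -
  interpret G: tournament G by fact
  interpret P7m: tournament P7m by (rule tournament_P7m)
  have in_P7m: "s \<in> verts P7m" "t \<in> verts P7m" if "s \<rightarrow>\<^bsub>P7m\<^esub> t" for s t
    using P7m.adj_in_verts[OF that] .
  have parts: "s \<in> {1, 2, 4} \<longleftrightarrow> s \<notin> {3, 5, 6}" if "s \<in> verts P7m" for s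
    using that unfolding verts_basic by auto
  have sub: "D1 P7m \<subseteq> verts P7m" "D2 P7m \<subseteq> verts P7m" by (auto simp: D1_def D2_def)
  show ?thesis
    unfolding P7m_join_def Let_def
  proof (rule tournament_with_proj, goal_cases)
    case (3 p q)
    show ?case
    proof (cases p; cases q)
      fix a b assume "p = Inl a" "q = Inl b"
      then show ?case using G.exactly_one_arc[of a b] 3 by auto
    next
      fix a t assume "p = Inl a" "q = Inr t"
      then show ?case using G.exactly_one_arc[of a v] G.exactly_one_arc[of a u] parts[of t] 3 assms(2,3)
        unfolding degree_partition_P7m by auto
    next
      fix s b assume "p = Inr s" "q = Inl b"
      then show ?case using G.exactly_one_arc[of v b] G.exactly_one_arc[of u b] parts[of s] 3 assms(2,3)
        unfolding degree_partition_P7m by auto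
    next
      fix s t assume "p = Inr s" "q = Inr t"
      then show ?case using P7m.exactly_one_arc[of s t] 3 by auto
    qed
  next
    case 1
    show ?case by simp
  next
    case 2
    show ?case using in_P7m sub by blast
  next
    case (4 p)
    show ?case using G.irrefl P7m.irrefl by (cases p) auto
  qed
qed

text \<open>A bridge supplies the assumptions of \<open>P7m_inserted\<close>. Contracting the second
  part to \<open>u\<close> and the first to \<open>v\<close> then keeps all arcs of a
  \<Delta>(1,2,2), since it meets the inserted part in at most one partner pair.\<close>

lemma is_free_P7m_join:
  fixes G :: "('a, 'b) pre_digraph"
  assumes "tournament G" and "is_free G Delta122" and "bridge G u v"
  shows "is_free (P7m_join G u v) Delta122"
proof -
  interpret G: tournament G by fact
  have uv: "u \<rightarrow>\<^bsub>G\<^esub> v" "u \<in> verts G" "v \<in> verts G"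
    using G.bridgeD(1)[OF assms(3)] G.adj_in_verts by auto
  interpret H: tournament "P7m_join G u v" by (rule tournament_P7m_join) fact+
  let ?E = "\<lambda>p q. p \<rightarrow>\<^bsub>P7m_join G u v\<^esub> q"
  let ?X = "(Inr :: int \<Rightarrow> 'a + int) ` {1, 2, 3, 4, 5, 6}"
  have outside: "\<exists>a. p = Inl a \<and> a \<in> verts G - {u, v}" if "p \<in> verts (P7m_join G u v) - ?X" for p
    using that unfolding verts_P7m_join by blast
  interpret P7m_inserted "verts (P7m_join G u v)" ?E Inr ?X
  proof (rule P7m_inserted.intro, goal_cases)
    case (1 p q)
    then show ?case by (rule H.asym)
  next
    case (2 p q)
    then show ?case by (rule H.total)
  next
    case 3
    show ?case unfolding verts_P7m_join by blast
  next
    case 4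
    show ?case by simp
  next
    case (5 i j)
    then show ?case unfolding arcs_ends_P7m_join arcs_ends_P7m verts_basic by blast
  next
    case (6 w)
    from outside[OF 6] obtain a where a: "w = Inl a" "a \<in> verts G - {u, v}" by blast
    have K: "?E w (Inr i) \<longleftrightarrow> i \<in> {3, 5, 6} \<and> a \<rightarrow>\<^bsub>G\<^esub> u \<or> i \<in> {1, 2, 4} \<and> a \<rightarrow>\<^bsub>G\<^esub> v" for i
      unfolding a(1) arcs_ends_P7m_join using a(2) by blast
    \<comment> \<open>No directed path of length two leads from \<open>u\<close> to
      \<open>v\<close>, which excludes the pattern \<open>{1, 2, 4}\<close>.\<close>
    have "a \<rightarrow>\<^bsub>G\<^esub> v \<Longrightarrow> a \<rightarrow>\<^bsub>G\<^esub> u"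
      using G.bridgeD(2)[OF assms(3), of a] G.total[of u a] uv a(2) by blast
    then consider "\<not> a \<rightarrow>\<^bsub>G\<^esub> u" "\<not> a \<rightarrow>\<^bsub>G\<^esub> v" | "a \<rightarrow>\<^bsub>G\<^esub> u" "\<not> a \<rightarrow>\<^bsub>G\<^esub> v" | "a \<rightarrow>\<^bsub>G\<^esub> u" "a \<rightarrow>\<^bsub>G\<^esub> v"
      by blast
    then show ?case
    proof cases
      case 1
      then have "{i \<in> {1, 2, 3, 4, 5, 6}. ?E w (Inr i)} = {}" using K by blast
      then show ?thesis by simp
    next
      case 2
      then have "{i \<in> {1, 2, 3, 4, 5, 6}. ?E w (Inr i)} = {1, 2, 3, 4, 5, 6} \<inter> {3, 5, 6}" using K by blast
      then show ?thesis by simp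
    next
      case 3
      then have "{i \<in> {1, 2, 3, 4, 5, 6}. ?E w (Inr i)} = {1, 2, 3, 4, 5, 6}" using K by blast
      then show ?thesis by simp
    qed
  next
    case (7 p q q')
    from outside[OF 7(1)] outside[OF 7(2)] outside[OF 7(3)] obtain a b b' where
      "p = Inl a" "q = Inl b" "q' = Inl b'" "{a, b, a, b'} \<inter> {u, v} = {}" by blast
    then show ?case
      using locally_matchedD[OF G.bridgeD(4)[OF assms(3)], of a b a b'] 7
      by (simp add: arcs_ends_P7m_join)
  next
    case (8 p p' q)
    from outside[OF 8(1)] outside[OF 8(2)] outside[OF 8(3)] obtain a a' b where
      "p = Inl a" "p' = Inl a'" "q = Inl b" "{a, b, a', b} \<inter> {u, v} = {}" by blast
    then show ?case
      using locally_matchedD[OF G.bridgeD(4)[OF assms(3)], of a b a' b] 8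
      by (simp add: arcs_ends_P7m_join)
  next
    case (9 p q q')
    from outside[OF 9(1)] outside[OF 9(2)] outside[OF 9(3)] obtain a b b' where
      "p = Inl a" "q = Inl b" "q' = Inl b'" "{a, b, a, b'} \<inter> {u, v} = {}" by blast
    then show ?case
      using locally_matchedD[OF G.bridgeD(3)[OF assms(3)], of a b a b'] 9
      by (simp add: arcs_ends_P7m_join)
  next
    case (10 p p' q)
    from outside[OF 10(1)] outside[OF 10(2)] outside[OF 10(3)] obtain a a' b where
      "p = Inl a" "p' = Inl a'" "q = Inl b" "{a, b, a', b} \<inter> {u, v} = {}" by blast
    then show ?case
      using locally_matchedD[OF G.bridgeD(3)[OF assms(3)], of a b a' b] 10
      by (simp add: arcs_ends_P7m_join)
  qed
  have "\<not> delta ?E x y1 y2 z1 z2" for x y1 y2 z1 z2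
  proof
    assume d: "delta ?E x y1 y2 z1 z2"
    define Z where "Z = {x, y1, y2, z1, z2}"
    have arcs: "?E x y1" "?E x y2" "?E y1 z1" "?E y1 z2" "?E y2 z1" "?E y2 z2" "?E z1 x" "?E z2 x"
      "y1 \<noteq> y2" "z1 \<noteq> z2"
      using d by (auto simp: delta_def)
    have Z: "Z \<subseteq> verts (P7m_join G u v)"
      unfolding Z_def using arcs(1-8)[THEN H.adj_in_verts(1)] by blast
    obtain i where i: "i \<in> {1, 2, 4}" "Z \<inter> ?X \<subseteq> {Inr i, Inr (7 - i)}"
      using delta_meets_one_pair[OF d] Z unfolding Z_def by blast
    define f :: "'a + int \<Rightarrow> 'a" where "f = case_sum (\<lambda>w. w) (\<lambda>k. if k \<in> {1, 2, 4} then v else u)"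
    have arc: "f p \<rightarrow>\<^bsub>G\<^esub> f q" if pq: "?E p q" "p \<in> Z" "q \<in> Z" for p q
    proof (cases p; cases q)
      fix s t assume st: "p = Inr s" "q = Inr t"
      then have "s \<rightarrow>\<^bsub>P7m\<^esub> t" using pq(1) by (simp add: arcs_ends_P7m_join)
      then have mem: "s \<in> {1, 2, 3, 4, 5, 6}" "t \<in> {1, 2, 3, 4, 5, 6}" and rot: "rot7 s t"
        unfolding arcs_ends_P7m verts_basic by blast+
      have "p \<in> {Inr i, Inr (7 - i)}" "q \<in> {Inr i, Inr (7 - i)}"
        using i(2) pq(2,3) mem unfolding st by blast+
      then have "s \<in> {i, 7 - i}" "t \<in> {i, 7 - i}" unfolding st by auto
      \<comment> \<open>Within a partner pair the only arc goes from \<open>7 - i\<close> to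
        \<open>i\<close>; it becomes the bridge \<open>uv\<close>.\<close>
      then have "s = 7 - i" "t = i" using i(1) rot by (auto simp: rot7_def)
      then show ?thesis using uv(1) i(1) st by (auto simp: f_def)
    qed (use pq(1) in \<open>auto simp: f_def arcs_ends_P7m_join\<close>)
    \<comment> \<open>Distinct vertices are adjacent, and so are their images by \<open>arc\<close>;
      injectivity follows since \<open>G\<close> has no loops.\<close>
    have "f p \<noteq> f q" if "p \<noteq> q" "p \<in> Z" "q \<in> Z" for p q
      using that arc[of p q] arc[of q p] H.total[of p q] G.irrefl[of "f q"] subsetD[OF Z] by auto
    then have "delta (\<lambda>a b. a \<rightarrow>\<^bsub>G\<^esub> b) (f x) (f y1) (f y2) (f z1) (f z2)"
      unfolding delta_def using arcs arc by (simp add: Z_def)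
    then show False using assms(2) G.is_free_Delta122_iff by blast
  qed
  then show ?thesis unfolding H.is_free_Delta122_iff by blast
qed

section \<open>Decomposition\<close>

context tournament
begin

text \<open>\<open>J\<close> keeps one vertex \<open>v\<close> of \<open>X\<close> and is induced in
  \<open>G\<close>, hence free. A second vertex of \<open>X\<close> makes \<open>J\<close> smaller
  and acts as a twin of \<open>v\<close>: two cyclic triangles showing that \<open>v\<close> is not
  nice would form a \<Delta>(1,2,2) with the pair.\<close>

lemma decompose_homogeneous:
  fixes S :: "('c, 'd) pre_digraph"
  assumes free: "is_free G Delta122" and "tournament S" and "X \<subseteq> verts G"
    and iso: "digraph_iso (G \<restriction> X) S" and hom: "homogeneous_set G X" and card: "1 < card (verts S)"
  obtains J :: "('a, 'b) pre_digraph" and v where "tournament J" and "is_free J Delta122"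
    and "card (verts J) < card (verts G)" and "nice_vertex J v" and "digraph_iso (substitute J v S) G"
proof -
  interpret S: tournament S by fact
  obtain g where bij: "bij_betw g (verts S) X"
    and arcs: "\<forall>i\<in>verts S. \<forall>j\<in>verts S. i \<rightarrow>\<^bsub>S\<^esub> j \<longleftrightarrow> g i \<rightarrow> g j"
    using iso unfolding digraph_iso_induce_iff[OF S.nomulti_digraph assms(3)] by (elim exE conjE)
  have card_X: "1 < card X" using bij_betw_same_card[OF bij] card by simp
  have "finite X" using assms(3) by (rule finite_subset) simp
  then obtain v v' where v: "v \<in> X" "v' \<in> X" "v \<noteq> v'"
    using card_X by (metis One_nat_def card_le_Suc0_iff_eq linorder_not_less)
  define W where "W = insert v (verts G - X)"
  have W: "W \<subseteq> verts G" using v assms(3) by (auto simp: W_def)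
  define J where "J = G \<restriction> W"
  have J: "tournament J" unfolding J_def by (rule tournament_induce[OF tournament W])
  then interpret J: tournament J .
  have J_verts: "verts J = W" by (simp add: J_def)
  have J_arcs: "a \<rightarrow>\<^bsub>J\<^esub> b \<longleftrightarrow> a \<rightarrow> b \<and> a \<in> W \<and> b \<in> W" for a b
    by (auto simp: J_def arcs_ends_induce)
  have uniform: "w \<rightarrow> x \<longleftrightarrow> w \<rightarrow> v" "x \<rightarrow> w \<longleftrightarrow> v \<rightarrow> w" if "w \<in> verts G - X" "x \<in> X" for w x
    using hom that v(1) asym unfolding homogeneous_set_def all_arcs_to_def by blast+
  have "W \<subset> verts G" using W v assms(3) by (auto simp: W_def)
  then have "card (verts J) < card (verts G)"
    unfolding J_verts by (rule psubset_card_mono[rotated]) simp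
  moreover have "nice_vertex J v"
    unfolding nice_vertex_def
  proof (intro conjI notI)
    show "v \<in> verts J" by (simp add: J_verts W_def)
    assume "\<exists>x y1 y2. distinct [x, y1, y2] \<and> cyclic_triangle J v x y1 \<and> cyclic_triangle J v x y2"
    then obtain x y1 y2 where dist: "y1 \<noteq> y2" and tri: "cyclic_triangle J v x y1" "cyclic_triangle J v x y2"
      by auto
    have out: "x \<in> verts G - X" "y1 \<in> verts G - X" "y2 \<in> verts G - X"
      using tri J.irrefl unfolding cyclic_triangle_def J_arcs W_def by auto
    show False
    proof (cases "v \<rightarrow> x")
      case True
      then have "v \<rightarrow> x" "x \<rightarrow> y1" "y1 \<rightarrow> v" "x \<rightarrow> y2" "y2 \<rightarrow> v"
        using tri asym unfolding cyclic_triangle_def J_arcs by blast+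
      then have "delta (\<lambda>a b. a \<rightarrow> b) x y1 y2 v v'"
        using dist v out uniform(1)[of _ v'] uniform(2)[of _ v'] by (simp add: delta_def)
      then show False using free is_free_Delta122_iff by blast
    next
      case False
      then have "x \<rightarrow> v" "y1 \<rightarrow> x" "v \<rightarrow> y1" "y2 \<rightarrow> x" "v \<rightarrow> y2"
        using tri asym unfolding cyclic_triangle_def J_arcs by blast+
      then have "delta (\<lambda>a b. a \<rightarrow> b) x v v' y1 y2"
        using dist v out uniform(1)[of _ v'] uniform(2)[of _ v'] by (simp add: delta_def)
      then show False using free is_free_Delta122_iff by blast
    qed
  qed
  moreover have "digraph_iso (substitute J v S) G"
  proof -
    have "v \<in> verts J" by (simp add: J_verts W_def)
    then interpret H: tournament "substitute J v S"
      by (rule tournament_substitute[OF J _ assms(2)])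
    define f :: "'a + 'c \<Rightarrow> 'a" where "f = case_sum (\<lambda>w. w) g"
    have W_v: "verts J - {v} = verts G - X" using v by (auto simp: J_verts W_def)
    have g: "g s \<in> X" if "s \<in> verts S" for s using bij that by (rule bij_betw_apply)
    have "bij_betw f (verts (substitute J v S)) (verts G)"
    proof -
      have "bij_betw f (Inl ` (verts G - X)) (verts G - X)"
        unfolding f_def by (rule bij_betwI[of _ _ _ Inl]) auto
      moreover have "bij_betw f (Inr ` verts S) X"
        using bij unfolding bij_betw_def f_def by (auto simp: inj_on_def image_image)
      ultimately have "bij_betw f (Inl ` (verts G - X) \<union> Inr ` verts S) ((verts G - X) \<union> X)"
        by (rule bij_betw_combine) blast
      moreover have "(verts G - X) \<union> X = verts G" using assms(3) by blast
      ultimately show ?thesis unfolding verts_substitute W_v by simp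
    qed
    moreover have "p \<rightarrow>\<^bsub>substitute J v S\<^esub> q \<longleftrightarrow> f p \<rightarrow> f q"
      if pq: "p \<in> verts (substitute J v S)" "q \<in> verts (substitute J v S)" for p q
    proof (cases p; cases q)
      fix a b assume "p = Inl a" "q = Inl b"
      then show ?thesis using pq unfolding verts_substitute W_v
        by (auto simp: arcs_ends_substitute W_v J_arcs f_def W_def)
    next
      fix a t assume "p = Inl a" "q = Inr t"
      then show ?thesis using pq uniform(1)[of a "g t"] g[of t] unfolding verts_substitute W_v
        by (auto simp: arcs_ends_substitute W_v J_arcs f_def W_def)
    next
      fix s b assume "p = Inr s" "q = Inl b"
      then show ?thesis using pq uniform(2)[of b "g s"] g[of s] unfolding verts_substitute W_v
        by (auto simp: arcs_ends_substitute W_v J_arcs f_def W_def)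
    next
      fix s t assume "p = Inr s" "q = Inr t"
      then show ?thesis using pq arcs unfolding verts_substitute
        by (auto simp: arcs_ends_substitute f_def)
    qed
    ultimately show ?thesis
      unfolding digraph_iso_iff[OF H.nomulti_digraph nomulti_digraph] by blast
  qed
  moreover have "is_free J Delta122" unfolding J_def by (rule is_free_induce[OF free W])
  ultimately show thesis using that J by blast
qed

text \<open>The ends of the bridge are a partner pair of the copy, \<open>g 3\<close> and
  \<open>g 4\<close>, kept as representatives of the two parts. Absence of \<open>P7\<close> leaves
  exactly the attachments compatible with a bridge.\<close>

lemma decompose_P7m:
  assumes free: "is_free G Delta122" and no_P7: "\<not> contains G P7"
    and "X \<subseteq> verts G" and "digraph_iso (G \<restriction> X) P7m"
  obtains J :: "('a, 'b) pre_digraph" and u v where "tournament J" and "is_free J Delta122"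
    and "card (verts J) < card (verts G)" and "bridge J u v" and "digraph_iso (P7m_join J u v) G"
proof -
  obtain g where bij: "bij_betw g {1, 2, 3, 4, 5, 6} X"
    and arcs: "\<forall>i\<in>{1, 2, 3, 4, 5, 6}. \<forall>j\<in>{1, 2, 3, 4, 5, 6}. g i \<rightarrow> g j \<longleftrightarrow> rot7 i j"
    and K: "\<forall>w\<in>verts G - X.
      {i \<in> {1, 2, 3, 4, 5, 6}. w \<rightarrow> g i} \<in> {{}, {1, 2, 4}, {3, 5, 6}, {1, 2, 3, 4, 5, 6}}"
    using P7m_copy[OF free assms(3,4)] by (elim exE conjE)
  note arcs = arcs[rule_format]
  have gX: "g i \<in> X" if "i \<in> {1, 2, 3, 4, 5, 6}" for i using bij that by (rule bij_betw_apply)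
  have inj: "inj_on g {1, 2, 3, 4, 5, 6}" using bij by (rule bij_betw_imp_inj_on)
  have into: "g i \<rightarrow> w \<longleftrightarrow> \<not> w \<rightarrow> g i" if "w \<in> verts G - X" "i \<in> {1, 2, 3, 4, 5, 6}" for w i
    using exactly_one_arc[of "g i" w] gX[OF that(2)] that(1) assms(3) by blast
  have attached: "(\<forall>i\<in>{1, 2, 4}. w \<rightarrow> g i \<longleftrightarrow> w \<rightarrow> g 4) \<and> (\<forall>i\<in>{3, 5, 6}. w \<rightarrow> g i \<longleftrightarrow> w \<rightarrow> g 3)
      \<and> (w \<rightarrow> g 4 \<longrightarrow> w \<rightarrow> g 3)" if w: "w \<in> verts G - X" for w
  proof -
    define L where "L = {i \<in> {1, 2, 3, 4, 5, 6}. w \<rightarrow> g i}"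
    have L: "w \<rightarrow> g i \<longleftrightarrow> i \<in> L" if "i \<in> {1, 2, 3, 4, 5, 6}" for i using that by (simp add: L_def)
    have "L \<noteq> {1, 2, 4}"
    proof
      assume L124: "L = {1, 2, 4}"
      interpret P7: tournament P7 by (rule tournament_P7)
      \<comment> \<open>Here \<open>w\<close> takes the place of the deleted vertex \<open>7\<close>
        and completes a copy of \<open>P7\<close>.\<close>
      have h: "(g(7 := w)) i = g i" if "i \<in> {1, 2, 3, 4, 5, 6}" for i using that by auto
      have "bij_betw (g(7 := w)) {1, 2, 3, 4, 5, 6} X"
        using bij_betw_cong[of "{1, 2, 3, 4, 5, 6}" "g(7 := w)" g X] h bij by blast
      then have "bij_betw (g(7 := w)) ({1, 2, 3, 4, 5, 6} \<union> {7}) (X \<union> {w})"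
        by (rule bij_betw_combine) (use w in \<open>auto simp: bij_betw_def\<close>)
      moreover have "{1, 2, 3, 4, 5, 6} \<union> {7} = verts P7" unfolding verts_basic by blast
      ultimately have bij7: "bij_betw (g(7 := w)) (verts P7) (insert w X)" by simp
      have "i \<rightarrow>\<^bsub>P7\<^esub> j \<longleftrightarrow> (g(7 := w)) i \<rightarrow> (g(7 := w)) j"
        if ij: "i \<in> verts P7" "j \<in> verts P7" for i j
      proof -
        have rot: "i \<rightarrow>\<^bsub>P7\<^esub> j \<longleftrightarrow> rot7 i j" using ij by (simp add: arcs_ends_P7)
        consider "i = 7" "j = 7" | "i = 7" "j \<in> {1, 2, 3, 4, 5, 6}" | "i \<in> {1, 2, 3, 4, 5, 6}" "j = 7"
          | "i \<in> {1, 2, 3, 4, 5, 6}" "j \<in> {1, 2, 3, 4, 5, 6}"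
          using ij unfolding verts_basic by blast
        then show ?thesis
        proof cases
          case 1 then show ?thesis unfolding rot by (simp add: rot7_def irrefl)
        next
          case 2
          have "rot7 7 j \<longleftrightarrow> j \<in> L" unfolding L124
            using 2(2) by (elim insertE emptyE) (simp_all add: rot7_def)
          then show ?thesis unfolding rot using 2 h L by simp
        next
          case 3
          have "rot7 i 7 \<longleftrightarrow> i \<notin> L" unfolding L124
            using 3(1) by (elim insertE emptyE) (simp_all add: rot7_def)
          then show ?thesis unfolding rot using 3 h L into[OF w] by simp
        next
          case 4 then show ?thesis unfolding rot using h arcs by simp
        qed
      qed
      then have "digraph_iso (G \<restriction> insert w X) P7"
        using bij7 assms(3) w digraph_iso_induce_iff[OF P7.nomulti_digraph, of "insert w X"] by blast
      then show False using no_P7 assms(3) w unfolding contains_def by blast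
    qed
    then consider "L = {}" | "L = {3, 5, 6}" | "L = {1, 2, 3, 4, 5, 6}"
      using bspec[OF K w, folded L_def] by (elim insertE emptyE) simp_all
    then show ?thesis by cases (simp_all add: L)
  qed
  define W where "W = insert (g 3) (insert (g 4) (verts G - X))"
  have g34: "g 3 \<in> X" "g 4 \<in> X" "g 3 \<noteq> g 4" using gX inj by (simp_all add: inj_on_eq_iff)
  have W: "W \<subseteq> verts G" using g34 assms(3) by (auto simp: W_def)
  define J where "J = G \<restriction> W"
  have J: "tournament J" unfolding J_def by (rule tournament_induce[OF tournament W])
  then interpret J: tournament J .
  have J_verts: "verts J = W" by (simp add: J_def)
  have J_arcs: "a \<rightarrow>\<^bsub>J\<^esub> b \<longleftrightarrow> a \<rightarrow> b \<and> a \<in> W \<and> b \<in> W" for a b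
    by (auto simp: J_def arcs_ends_induce)
  \<comment> \<open>A vertex lost in the contraction, so \<open>J\<close> is strictly
    smaller.\<close>
  have "g 1 \<in> verts G - W"
    using gX[of 1] assms(3) inj by (auto simp: W_def)
  then have "W \<subset> verts G" using W by blast
  then have card: "card (verts J) < card (verts G)"
    unfolding J_verts by (rule psubset_card_mono[rotated]) simp
  have free_J: "is_free J Delta122" unfolding J_def by (rule is_free_induce[OF free W])
  have out: "w \<in> verts G - X" if "w \<in> W" "w \<notin> {g 3, g 4}" for w
    using that by (simp add: W_def)
  have above_D1: "w \<rightarrow> g 1" "w \<rightarrow> g 2" if "w \<in> verts G - X" "w \<rightarrow> g 4" for w
    using attached[OF that(1)] that(2) by simp_all
  have below_D1: "g 1 \<rightarrow> w" "g 2 \<rightarrow> w" if "w \<in> verts G - X" "g 4 \<rightarrow> w" for w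
    using attached[OF that(1)] that into[OF that(1)] by simp_all
  have above_D2: "w \<rightarrow> g 3" "w \<rightarrow> g 5" if "w \<in> verts G - X" "w \<rightarrow> g 3" for w
    using attached[OF that(1)] that(2) by simp_all
  have below_D2: "g 3 \<rightarrow> w" "g 5 \<rightarrow> w" if "w \<in> verts G - X" "g 3 \<rightarrow> w" for w
    using attached[OF that(1)] that into[OF that(1)] by simp_all
  have distinct: "g 1 \<noteq> g 2" "g 3 \<noteq> g 5" using inj by simp_all
  have no_delta: "\<not> delta (\<lambda>a b. a \<rightarrow> b) x y1 y2 z1 z2" for x y1 y2 z1 z2
    using free is_free_Delta122_iff by blast
  \<comment> \<open>Vertices \<open>p\<close> and \<open>q\<close> are attached to the outside as
    \<open>c\<close> is. Two arcs back across \<open>c\<close> with a common head or tail then yield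
    a \<Delta>(1,2,2) in which \<open>p\<close> and \<open>q\<close> form one of the pairs.\<close>
  have matched: "locally_matched J {g 3, g 4} c"
    if c: "\<And>w. w \<in> verts G - X \<Longrightarrow> w \<rightarrow> c \<Longrightarrow> w \<rightarrow> p \<and> w \<rightarrow> q"
      "\<And>w. w \<in> verts G - X \<Longrightarrow> c \<rightarrow> w \<Longrightarrow> p \<rightarrow> w \<and> q \<rightarrow> w" and "p \<noteq> q" for c p q
    unfolding locally_matched_def
  proof (intro allI impI)
    fix a b a' b'
    assume *: "{a, b, a', b'} \<inter> {g 3, g 4} = {} \<and> a \<rightarrow>\<^bsub>J\<^esub> c \<and> c \<rightarrow>\<^bsub>J\<^esub> b \<and> b \<rightarrow>\<^bsub>J\<^esub> a \<and>
      a' \<rightarrow>\<^bsub>J\<^esub> c \<and> c \<rightarrow>\<^bsub>J\<^esub> b' \<and> b' \<rightarrow>\<^bsub>J\<^esub> a' \<and> (a = a' \<or> b = b')"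
    then have backs: "b \<rightarrow> a" "b' \<rightarrow> a'" and "a \<rightarrow> c" "c \<rightarrow> b" "a' \<rightarrow> c" "c \<rightarrow> b'"
      and "a \<in> verts G - X" "b \<in> verts G - X" "a' \<in> verts G - X" "b' \<in> verts G - X"
      using out[of a] out[of b] out[of a'] out[of b'] unfolding J_arcs by auto
    then have pq: "a \<rightarrow> p" "a \<rightarrow> q" "a' \<rightarrow> p" "a' \<rightarrow> q" "p \<rightarrow> b" "q \<rightarrow> b" "p \<rightarrow> b'" "q \<rightarrow> b'"
      using c by blast+
    have "b = b'" if "a = a'"
      using no_delta[of a p q b b'] pq backs \<open>p \<noteq> q\<close> that by (simp add: delta_def)
    moreover have "a = a'" if "b = b'"
      using no_delta[of b a a' p q] pq backs \<open>p \<noteq> q\<close> that by (simp add: delta_def)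
    ultimately show "a = a' \<and> b = b'" using * by blast
  qed
  have "g 3 \<rightarrow> g 4" using arcs[of 3 4] by (simp add: rot7_def)
  have bridge: "bridge J (g 3) (g 4)"
  proof (rule J.bridgeI)
    show "g 3 \<rightarrow>\<^bsub>J\<^esub> g 4" using \<open>g 3 \<rightarrow> g 4\<close> by (simp add: J_arcs W_def)
    show "\<not> (g 3 \<rightarrow>\<^bsub>J\<^esub> w \<and> w \<rightarrow>\<^bsub>J\<^esub> g 4)" for w
    proof
      assume w: "g 3 \<rightarrow>\<^bsub>J\<^esub> w \<and> w \<rightarrow>\<^bsub>J\<^esub> g 4"
      then have "w \<in> verts G - X" using out[of w] J.irrefl[of "g 3"] J.irrefl[of "g 4"] unfolding J_arcs by auto
      then show False using attached[of w] w asym[of w "g 3"] unfolding J_arcs by blast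
    qed
    \<comment> \<open>The twins come from the part that the vertex represents: \<open>g 3\<close>
      and \<open>g 5\<close> for \<open>g 3\<close>, \<open>g 1\<close> and \<open>g 2\<close> for
      \<open>g 4\<close>.\<close>
    show "locally_matched J {g 3, g 4} (g 3)"
      by (rule matched[of _ "g 3" "g 5"]) (use above_D2 below_D2 distinct in blast)+
    show "locally_matched J {g 3, g 4} (g 4)"
      by (rule matched[of _ "g 1" "g 2"]) (use above_D1 below_D1 distinct in blast)+
  qed
  moreover have "digraph_iso (P7m_join J (g 3) (g 4)) G"
  proof -
    have "g 3 \<in> verts J" "g 4 \<in> verts J" by (simp_all add: J_verts W_def)
    then interpret H: tournament "P7m_join J (g 3) (g 4)"
      by (rule tournament_P7m_join[OF J])
    define f :: "'a + int \<Rightarrow> 'a" where "f = case_sum (\<lambda>w. w) g"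
    have W_uv: "verts J - {g 3, g 4} = verts G - X" using g34 by (auto simp: J_verts W_def)
    have sub_W: "w \<in> verts G - X \<Longrightarrow> w \<in> W" for w by (simp add: W_def)
    have in_W: "g 3 \<in> W" "g 4 \<in> W" by (simp_all add: W_def)
    have to_X: "w \<rightarrow> g i \<longleftrightarrow> i \<in> {3, 5, 6} \<and> w \<rightarrow>\<^bsub>J\<^esub> g 3 \<or> i \<in> {1, 2, 4} \<and> w \<rightarrow>\<^bsub>J\<^esub> g 4"
      "g i \<rightarrow> w \<longleftrightarrow> i \<in> {3, 5, 6} \<and> g 3 \<rightarrow>\<^bsub>J\<^esub> w \<or> i \<in> {1, 2, 4} \<and> g 4 \<rightarrow>\<^bsub>J\<^esub> w"
      if w: "w \<in> verts G - X" and i: "i \<in> {1, 2, 3, 4, 5, 6}" for w i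
    proof -
      have J_iff: "w \<rightarrow>\<^bsub>J\<^esub> g 3 \<longleftrightarrow> w \<rightarrow> g 3" "w \<rightarrow>\<^bsub>J\<^esub> g 4 \<longleftrightarrow> w \<rightarrow> g 4"
        "g 3 \<rightarrow>\<^bsub>J\<^esub> w \<longleftrightarrow> \<not> w \<rightarrow> g 3" "g 4 \<rightarrow>\<^bsub>J\<^esub> w \<longleftrightarrow> \<not> w \<rightarrow> g 4"
        using into[OF w, of 3] into[OF w, of 4] by (simp_all add: J_arcs sub_W[OF w] in_W)
      consider "i \<in> {1, 2, 4}" "i \<notin> {3, 5, 6}" | "i \<in> {3, 5, 6}" "i \<notin> {1, 2, 4}" using i by auto
      then have "w \<rightarrow> g i \<longleftrightarrow> i \<in> {3, 5, 6} \<and> w \<rightarrow> g 3 \<or> i \<in> {1, 2, 4} \<and> w \<rightarrow> g 4"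
        and "\<not> w \<rightarrow> g i \<longleftrightarrow> i \<in> {3, 5, 6} \<and> \<not> w \<rightarrow> g 3 \<or> i \<in> {1, 2, 4} \<and> \<not> w \<rightarrow> g 4"
        using attached[OF w] by (cases, metis, metis)+
      then show "w \<rightarrow> g i \<longleftrightarrow> i \<in> {3, 5, 6} \<and> w \<rightarrow>\<^bsub>J\<^esub> g 3 \<or> i \<in> {1, 2, 4} \<and> w \<rightarrow>\<^bsub>J\<^esub> g 4"
        "g i \<rightarrow> w \<longleftrightarrow> i \<in> {3, 5, 6} \<and> g 3 \<rightarrow>\<^bsub>J\<^esub> w \<or> i \<in> {1, 2, 4} \<and> g 4 \<rightarrow>\<^bsub>J\<^esub> w"
        unfolding J_iff into[OF w i] by blast+
    qed
    have "bij_betw f (verts (P7m_join J (g 3) (g 4))) (verts G)"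
    proof -
      have "bij_betw f (Inl ` (verts G - X)) (verts G - X)"
        unfolding f_def by (rule bij_betwI[of _ _ _ Inl]) auto
      moreover have "bij_betw f (Inr ` {1, 2, 3, 4, 5, 6}) X"
      proof -
        have "inj_on f (Inr ` {1, 2, 3, 4, 5, 6})"
          by (rule inj_on_imageI) (use inj in \<open>simp add: f_def comp_def\<close>)
        moreover have "f ` Inr ` {1, 2, 3, 4, 5, 6} = X"
          using bij unfolding bij_betw_def f_def image_image by simp
        ultimately show ?thesis by (simp only: bij_betw_def)
      qed
      ultimately have "bij_betw f (Inl ` (verts G - X) \<union> Inr ` {1, 2, 3, 4, 5, 6}) ((verts G - X) \<union> X)"
        by (rule bij_betw_combine) blast
      moreover have "(verts G - X) \<union> X = verts G" using assms(3) by blast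
      ultimately show ?thesis unfolding verts_P7m_join W_uv by simp
    qed
    moreover have "p \<rightarrow>\<^bsub>P7m_join J (g 3) (g 4)\<^esub> q \<longleftrightarrow> f p \<rightarrow> f q"
      if pq: "p \<in> verts (P7m_join J (g 3) (g 4))" "q \<in> verts (P7m_join J (g 3) (g 4))" for p q
    proof (cases p; cases q)
      fix a b assume ab: "p = Inl a" "q = Inl b"
      then have "a \<in> verts G - X" "b \<in> verts G - X" using pq unfolding verts_P7m_join W_uv by blast+
      then show ?thesis unfolding ab arcs_ends_P7m_join W_uv J_arcs by (simp add: f_def sub_W)
    next
      fix a t assume eqs: "p = Inl a" "q = Inr t"
      then have "a \<in> verts G - X" "t \<in> {1, 2, 3, 4, 5, 6}" using pq unfolding verts_P7m_join W_uv by blast+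
      from this(1) to_X(1)[OF this] show ?thesis unfolding eqs arcs_ends_P7m_join W_uv f_def sum.case by blast
    next
      fix s b assume sb: "p = Inr s" "q = Inl b"
      then have "b \<in> verts G - X" "s \<in> {1, 2, 3, 4, 5, 6}" using pq unfolding verts_P7m_join W_uv by blast+
      from this(1) to_X(2)[OF this] show ?thesis unfolding sb arcs_ends_P7m_join W_uv f_def sum.case by blast
    next
      fix s t assume st: "p = Inr s" "q = Inr t"
      then have "s \<in> {1, 2, 3, 4, 5, 6}" "t \<in> {1, 2, 3, 4, 5, 6}" using pq unfolding verts_P7m_join by blast+
      with arcs[OF this] show ?thesis
        unfolding st arcs_ends_P7m_join arcs_ends_P7m verts_basic f_def sum.case by blast
    qed
    ultimately show ?thesis
      unfolding digraph_iso_iff[OF H.nomulti_digraph nomulti_digraph] by blast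
  qed
  ultimately show thesis using that J free_J card by blast
qed

end

theorem theorem3p8:
  fixes T :: "('a, 'b) pre_digraph" and X :: "'a set"
  assumes "tournament T"
    and "is_free T Delta122"
    and "X \<subseteq> verts T"
  shows
    "(digraph_iso (T \<restriction> X) T5 \<or> digraph_iso (T \<restriction> X) P7 \<longrightarrow> homogeneous_set T X)
     \<and> (digraph_iso (T \<restriction> X) P7m \<longrightarrow> homogeneous_pair T (D1 (T \<restriction> X)) (D2 (T \<restriction> X)))
     \<and> (\<forall>v S. nice_vertex T v \<and> S \<in> basic_tournaments \<longrightarrow>
          tournament (substitute T v S) \<and> is_free (substitute T v S) Delta122)
     \<and> (\<forall>u v. bridge T u v \<longrightarrow>
          tournament (P7m_join T u v) \<and> is_free (P7m_join T u v) Delta122)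
     \<and> ((\<exists>S \<in> basic_tournaments. contains T S) \<longrightarrow>
          (\<exists>J :: ('a, 'b) pre_digraph.
             tournament J \<and> is_free J Delta122 \<and> card (verts J) < card (verts T) \<and>
             ((\<exists>v S. nice_vertex J v \<and> S \<in> basic_tournaments \<and>
                 digraph_iso (substitute J v S) T)
              \<or> (\<exists>u v. bridge J u v \<and> digraph_iso (P7m_join J u v) T))))"
proof (intro conjI allI impI)
  interpret T: tournament T by fact
  show "homogeneous_set T X" if "digraph_iso (T \<restriction> X) T5 \<or> digraph_iso (T \<restriction> X) P7"
    using that T.homogeneous_set_T5[OF assms(2,3)] T.homogeneous_set_P7[OF assms(2,3)] by blast
  show "homogeneous_pair T (D1 (T \<restriction> X)) (D2 (T \<restriction> X))" if "digraph_iso (T \<restriction> X) P7m"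
    using T.homogeneous_pair_P7m[OF assms(2,3) that] .
  show "tournament (substitute T v S)" if "nice_vertex T v \<and> S \<in> basic_tournaments" for v S
    using that tournament_substitute[OF assms(1) _ basic_tournament] by (simp add: nice_vertex_def)
  show "is_free (substitute T v S) Delta122" if "nice_vertex T v \<and> S \<in> basic_tournaments" for v S
  proof -
    from that have S: "tournament S" by (simp add: basic_tournament)
    then interpret S: tournament S .
    have "is_free S Delta122" using that basic_free S.is_free_Delta122_iff by blast
    then show ?thesis using is_free_substitute[OF assms(1,2)] that S by blast
  qed
  show "tournament (P7m_join T u v)" if "bridge T u v" for u v
    using T.bridgeD(1)[OF that] T.adj_in_verts tournament_P7m_join[OF assms(1)] by blast
  show "is_free (P7m_join T u v) Delta122" if "bridge T u v" for u v
    by (rule is_free_P7m_join[OF assms(1,2) that])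
  assume basic: "\<exists>S \<in> basic_tournaments. contains T S"
  show "\<exists>J :: ('a, 'b) pre_digraph.
      tournament J \<and> is_free J Delta122 \<and> card (verts J) < card (verts T) \<and>
      ((\<exists>v S. nice_vertex J v \<and> S \<in> basic_tournaments \<and> digraph_iso (substitute J v S) T)
       \<or> (\<exists>u v. bridge J u v \<and> digraph_iso (P7m_join J u v) T))"
  \<comment> \<open>Copies of \<open>T5\<close> and \<open>P7\<close> come first, so that
    \<open>P7\<close> is absent when a copy of \<open>P7m\<close> has to be contracted to a
    bridge.\<close>
  proof (cases "contains T T5 \<or> contains T P7")
    case True
    then obtain S Y where S: "S = T5 \<or> S = P7" and Y: "Y \<subseteq> verts T" "digraph_iso (T \<restriction> Y) S"
      unfolding contains_def by blast
    have hom: "homogeneous_set T Y"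
      using S Y T.homogeneous_set_T5[OF assms(2)] T.homogeneous_set_P7[OF assms(2)] by blast
    have S_basic: "S \<in> basic_tournaments" and card: "1 < card (verts S)"
      using S by (auto simp: basic_tournaments_def verts_basic)
    show ?thesis
      by (rule T.decompose_homogeneous[OF assms(2) basic_tournament[OF S_basic] Y hom card])
        (use S_basic in blast)
  next
    case False
    then obtain Y where Y: "Y \<subseteq> verts T" "digraph_iso (T \<restriction> Y) P7m"
      using basic unfolding basic_tournaments_def contains_def by blast
    have "\<not> contains T P7" using False by blast
    from T.decompose_P7m[OF assms(2) this Y] show ?thesis by metis
  qed
qed

end
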